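(* Let $\mathfrak q$ be a finite-dimensional algebraic Lie algebra over $\Bbbk$, let $\vartheta\in\mathrm{Aut}(\mathfrak q)$ be an automorphism of finite order $m\ge 2$, and let $\varphi:\Bbbk^\star\to \mathrm{GL}(\mathfrak q)$ be the polynomial representation with $\varphi_s(x)=s^jx$ for $x\in\mathfrak q_j$, $0\le j\le m-1$. Let $\{x,y\}_{(s)}=[x,y]_{(s)}=\varphi_s^{-1}[\varphi_s(x),\varphi_s(y)]$ for $x,y\in\mathfrak q$, $s\in\Bbbk^\star$. Then: (i) The map $\varphi_s^{-1}:\mathfrak q\to\mathfrak q$ is an isomorphism between $(\mathfrak q,[\,,\,])$ and $(\mathfrak q,[\,,\,]_{(s)})$. In particular, the Poisson brackets $\{\,,\,\}_{(s)}$, $s\in\Bbbk^\star$, are isomorphic. (ii) There is a limit $\lim_{s\to 0}\{x,y\}_{(s)}=:\{x,y\}_0$, which is a linear Poisson bracket in $\mathcal S(\mathfrak q)$. (iii) The difference $\{\,,\,\}_\infty:=\{\,,\,\}-\{\,,\,\}_0$ is a linear Poisson bracket on $\mathcal S(\mathfrak q)$, and $\{\,,\,\}_{(s)}=\{\,,\,\}_0+s^m\{\,,\,\}_\infty$ for any $s\in\Bbbk^\star$. (iv) The Poisson bracket $\{\,,\,\}_\infty$ is obtained as the zero limit with respect to the polynomial representation $\psi:\Bbbk^\star\to\mathrm{GL}(\mathfrak q)$ given by $\psi_s=s^m\cdot\varphi_{s^{-1}}=s^m\cdot\varphi_s^{-1}$, $s\in\Bbbk^\star$; that is, $\{\,,\,\}_\infty=\lim_{s\to0}\{\,,\,\}_{(\psi,s)}$,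 where $\{x,y\}_{(\psi,s)}=\psi_s^{-1}[\psi_s(x),\psi_s(y)]$ for $x,y\in\mathfrak q$.
   Context: The ground field $\Bbbk$ is algebraically closed of characteristic $0$; $\Bbbk^\star=\Bbbk\setminus\{0\}$. A Lie algebra $\mathfrak q$ is algebraic if $\mathfrak q=\mathrm{Lie}\,Q$ for a connected affine algebraic group $Q$. Fix a primitive $m$-th root of unity $\zeta$; for $j\in\{0,1,\dots,m-1\}$, $\mathfrak q_j=\{x\in\mathfrak q\mid\vartheta(x)=\zeta^jx\}$, so $\mathfrak q=\bigoplus_{j=0}^{m-1}\mathfrak q_j$ is a $\mathbb Z_m$-grading. $\mathcal S(\mathfrak q)=\Bbbk[\mathfrak q^*]$ is the symmetric algebra. The Lie–Poisson bracket $\{\,,\,\}$ on $\mathcal S(\mathfrak q)$ is given by $\{x,y\}=[x,y]$ for $x,y\in\mathfrak q$ and extended by the Leibniz rule. A Poisson bracket on $\mathcal S(\mathfrak q)$ is linear if the bracket of two elements of $\mathfrak q$ lies in $\mathfrak q$ (so it is the Lie–Poisson bracket of a Lie algebra structure on the vector space $\mathfrak q$); all brackets in the claim are given on $\mathfrak q$ and extended by the Leibniz rule. A representation of $\Bbbk^\star$ is polynomial if its matrix entries are polynomials in $s$. Limits $s\to0$ are understood algebraically: the bracket depends polynomially on $s$ and one evaluates at $s=0$. *)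

theory Defs
  imports
    "HOL-Computational_Algebra.Polynomial"
    "HOL-Library.Function_Algebras"
    "HOL-Algebra.Group"
begin

section \<open>Algebras of polynomial functions\<close>

text \<open>
  The unital algebra of functions on the set \<open>X\<close> generated by the restrictions of the
  functions in \<open>G\<close>. A function on \<open>X\<close> is represented by a total function that
  vanishes off \<open>X\<close>; addition and multiplication are pointwise, and the unit is the
  indicator function of \<open>X\<close>.
\<close>

inductive_set poly_funs :: "'a set \<Rightarrow> ('a \<Rightarrow> 'k::comm_ring_1) set \<Rightarrow> ('a \<Rightarrow> 'k) set"
  for X :: "'a set" and G :: "('a \<Rightarrow> 'k::comm_ring_1) set"
  where
    const: "(\<lambda>x. if x \<in> X then c else 0) \<in> poly_funs X G"
  | gen: "g \<in> G \<Longrightarrow> (\<lambda>x. if x \<in> X then g x else 0) \<in> poly_funs X G"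
  | add: "f \<in> poly_funs X G \<Longrightarrow> g \<in> poly_funs X G \<Longrightarrow> f + g \<in> poly_funs X G"
  | mult: "f \<in> poly_funs X G \<Longrightarrow> g \<in> poly_funs X G \<Longrightarrow> f * g \<in> poly_funs X G"

definition fscale :: "'k::comm_ring_1 \<Rightarrow> ('a \<Rightarrow> 'k) \<Rightarrow> 'a \<Rightarrow> 'k"
  where "fscale c f = (\<lambda>x. c * f x)"


section \<open>Lie algebras\<close>

text \<open>A vector space is a type together with its scalar multiplication \<open>sc\<close>.\<close>

definition fin_dim :: "('k::field \<Rightarrow> 'q::ab_group_add \<Rightarrow> 'q) \<Rightarrow> bool"
  where "fin_dim sc \<longleftrightarrow> (\<exists>B. finite_dimensional_vector_space sc B)"

locale lie_algebra = vector_space sc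
  for sc :: "'k::field \<Rightarrow> 'q::ab_group_add \<Rightarrow> 'q" +
  fixes br :: "'q \<Rightarrow> 'q \<Rightarrow> 'q"
  assumes linear_left: "Vector_Spaces.linear sc sc (\<lambda>x. br x y)"
    and linear_right: "Vector_Spaces.linear sc sc (br x)"
    and alternating: "br x x = 0"
    and jacobi: "br x (br y z) + br y (br z x) + br z (br x y) = 0"

definition lie_iso ::
  "('k::field \<Rightarrow> 'q::ab_group_add \<Rightarrow> 'q) \<Rightarrow> ('q \<Rightarrow> 'q \<Rightarrow> 'q) \<Rightarrow> ('q \<Rightarrow> 'q \<Rightarrow> 'q) \<Rightarrow> ('q \<Rightarrow> 'q) \<Rightarrow> bool"
  where "lie_iso sc br br' F \<longleftrightarrow>
    lie_algebra sc br \<and> lie_algebra sc br' \<and> Vector_Spaces.linear sc sc F \<and> bij F \<and>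
    (\<forall>x y. F (br x y) = br' (F x) (F y))"


section \<open>Algebraic Lie algebras\<close>

text \<open>Affine \<open>N\<close>-space; a point is a sequence of coordinates vanishing from index \<open>N\<close> on.\<close>

definition affine_space :: "nat \<Rightarrow> (nat \<Rightarrow> 'k::field) set"
  where "affine_space N = {v. \<forall>i\<ge>N. v i = 0}"

definition regular_funs :: "nat \<Rightarrow> (nat \<Rightarrow> 'k::field) set \<Rightarrow> ((nat \<Rightarrow> 'k) \<Rightarrow> 'k) set"
  where "regular_funs N X = poly_funs X ((\<lambda>i v. v i) ` {..<N})"

definition regular_funs2 ::
  "nat \<Rightarrow> (nat \<Rightarrow> 'k::field) set \<Rightarrow> ((nat \<Rightarrow> 'k) \<times> (nat \<Rightarrow> 'k) \<Rightarrow> 'k) set"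
  where "regular_funs2 N X =
    poly_funs (X \<times> X) ((\<lambda>i p. fst p i) ` {..<N} \<union> (\<lambda>i p. snd p i) ` {..<N})"

definition zariski_closed :: "nat \<Rightarrow> (nat \<Rightarrow> 'k::field) set \<Rightarrow> bool"
  where "zariski_closed N X \<longleftrightarrow>
    (\<exists>E. E \<subseteq> regular_funs N (affine_space N) \<and> X = {v \<in> affine_space N. \<forall>p\<in>E. p v = 0})"

definition zariski_connected :: "nat \<Rightarrow> (nat \<Rightarrow> 'k::field) set \<Rightarrow> bool"
  where "zariski_connected N X \<longleftrightarrow>
    \<not> (\<exists>A B. zariski_closed N A \<and> zariski_closed N B \<and> A \<noteq> {} \<and> B \<noteq> {} \<and>
          A \<inter> B = {} \<and> A \<union> B = X)"

text \<open>
  An affine variety with a group structure whose multiplication and inversion are morphisms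
  of varieties, i.e. have regular coordinate functions.
\<close>

definition affine_algebraic_group :: "nat \<Rightarrow> (nat \<Rightarrow> 'k::field) monoid \<Rightarrow> bool"
  where "affine_algebraic_group N Q \<longleftrightarrow>
    group Q \<and> zariski_closed N (carrier Q) \<and>
    (\<forall>j<N. (\<lambda>p. if p \<in> carrier Q \<times> carrier Q then (fst p \<otimes>\<^bsub>Q\<^esub> snd p) j else 0)
              \<in> regular_funs2 N (carrier Q)) \<and>
    (\<forall>j<N. (\<lambda>v. if v \<in> carrier Q then (inv\<^bsub>Q\<^esub> v) j else 0) \<in> regular_funs N (carrier Q))"

definition left_translate ::
  "(nat \<Rightarrow> 'k::field) monoid \<Rightarrow> (nat \<Rightarrow> 'k) \<Rightarrow> ((nat \<Rightarrow> 'k) \<Rightarrow> 'k) \<Rightarrow> (nat \<Rightarrow> 'k) \<Rightarrow> 'k"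
  where "left_translate Q g f = (\<lambda>v. if v \<in> carrier Q then f (inv\<^bsub>Q\<^esub> g \<otimes>\<^bsub>Q\<^esub> v) else 0)"

text \<open>
  The Lie algebra of \<open>Q\<close>: left-invariant derivations of the coordinate algebra, with the
  commutator as bracket. Derivations are extended by \<open>0\<close> off the coordinate algebra.
\<close>

definition lie_of_group ::
  "nat \<Rightarrow> (nat \<Rightarrow> 'k::field) monoid \<Rightarrow> (((nat \<Rightarrow> 'k) \<Rightarrow> 'k) \<Rightarrow> ((nat \<Rightarrow> 'k) \<Rightarrow> 'k)) set"
  where "lie_of_group N Q = (let A = regular_funs N (carrier Q) in
    {D. (\<forall>f\<in>A. D f \<in> A) \<and> (\<forall>f. f \<notin> A \<longrightarrow> D f = 0) \<and>
        (\<forall>f\<in>A. \<forall>g\<in>A. D (f + g) = D f + D g) \<and>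
        (\<forall>c. \<forall>f\<in>A. D (fscale c f) = fscale c (D f)) \<and>
        (\<forall>f\<in>A. \<forall>g\<in>A. D (f * g) = D f * g + f * D g) \<and>
        (\<forall>h\<in>carrier Q. \<forall>f\<in>A. D (left_translate Q h f) = left_translate Q h (D f))})"

definition algebraic_lie_algebra ::
  "('k::field \<Rightarrow> 'q::ab_group_add \<Rightarrow> 'q) \<Rightarrow> ('q \<Rightarrow> 'q \<Rightarrow> 'q) \<Rightarrow> bool"
  where "algebraic_lie_algebra sc br \<longleftrightarrow> lie_algebra sc br \<and>
    (\<exists>N Q. affine_algebraic_group N Q \<and> zariski_connected N (carrier Q) \<and>
      (\<exists>F. bij_betw F UNIV (lie_of_group N Q) \<and>
        (\<forall>x y. F (x + y) = F x + F y) \<and>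
        (\<forall>c x f. F (sc c x) f = fscale c (F x f)) \<and>
        (\<forall>x y f. F (br x y) f = F x (F y f) - F y (F x f))))"


section \<open>The symmetric algebra and Poisson brackets\<close>

text \<open>
  The symmetric algebra is the algebra of polynomial functions on the dual space. (The ground
  field is infinite, so polynomial functions and polynomials are the same thing.)
\<close>

definition dual_space :: "('k::field \<Rightarrow> 'q::ab_group_add \<Rightarrow> 'q) \<Rightarrow> ('q \<Rightarrow> 'k) set"
  where "dual_space sc = {\<xi>. Vector_Spaces.linear sc (*) \<xi>}"

definition Sym :: "('k::field \<Rightarrow> 'q::ab_group_add \<Rightarrow> 'q) \<Rightarrow> (('q \<Rightarrow> 'k) \<Rightarrow> 'k) set"
  where "Sym sc = poly_funs (dual_space sc) (range (\<lambda>x \<xi>. \<xi> x))"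

definition sym_of :: "('k::field \<Rightarrow> 'q::ab_group_add \<Rightarrow> 'q) \<Rightarrow> 'q \<Rightarrow> ('q \<Rightarrow> 'k) \<Rightarrow> 'k"
  where "sym_of sc x = (\<lambda>\<xi>. if \<xi> \<in> dual_space sc then \<xi> x else 0)"

definition biderivation ::
  "('k::field \<Rightarrow> 'q::ab_group_add \<Rightarrow> 'q) \<Rightarrow>
   ((('q \<Rightarrow> 'k) \<Rightarrow> 'k) \<Rightarrow> (('q \<Rightarrow> 'k) \<Rightarrow> 'k) \<Rightarrow> (('q \<Rightarrow> 'k) \<Rightarrow> 'k)) \<Rightarrow> bool"
  where "biderivation sc P \<longleftrightarrow>
    (\<forall>f\<in>Sym sc. \<forall>g\<in>Sym sc. P f g \<in> Sym sc) \<and>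
    (\<forall>f\<in>Sym sc. \<forall>g\<in>Sym sc. \<forall>h\<in>Sym sc.
       P (f + g) h = P f h + P g h \<and> P h (f + g) = P h f + P h g) \<and>
    (\<forall>c. \<forall>f\<in>Sym sc. \<forall>g\<in>Sym sc.
       P (fscale c f) g = fscale c (P f g) \<and> P f (fscale c g) = fscale c (P f g)) \<and>
    (\<forall>f\<in>Sym sc. \<forall>g\<in>Sym sc. \<forall>h\<in>Sym sc.
       P (f * g) h = f * P g h + P f h * g \<and> P h (f * g) = f * P h g + P h f * g)"

definition poisson_bracket ::
  "('k::field \<Rightarrow> 'q::ab_group_add \<Rightarrow> 'q) \<Rightarrow>
   ((('q \<Rightarrow> 'k) \<Rightarrow> 'k) \<Rightarrow> (('q \<Rightarrow> 'k) \<Rightarrow> 'k) \<Rightarrow> (('q \<Rightarrow> 'k) \<Rightarrow> 'k)) \<Rightarrow> bool"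
  where "poisson_bracket sc P \<longleftrightarrow> biderivation sc P \<and>
    (\<forall>f\<in>Sym sc. P f f = 0) \<and>
    (\<forall>f\<in>Sym sc. \<forall>g\<in>Sym sc. \<forall>h\<in>Sym sc. P f (P g h) + P g (P h f) + P h (P f g) = 0)"

definition linear_poisson_bracket ::
  "('k::field \<Rightarrow> 'q::ab_group_add \<Rightarrow> 'q) \<Rightarrow>
   ((('q \<Rightarrow> 'k) \<Rightarrow> 'k) \<Rightarrow> (('q \<Rightarrow> 'k) \<Rightarrow> 'k) \<Rightarrow> (('q \<Rightarrow> 'k) \<Rightarrow> 'k)) \<Rightarrow> bool"
  where "linear_poisson_bracket sc P \<longleftrightarrow> poisson_bracket sc P \<and>
    (\<forall>x y. \<exists>z. P (sym_of sc x) (sym_of sc y) = sym_of sc z)"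

text \<open>
  The extension to the symmetric algebra, by the Leibniz rule, of a bilinear operation on the
  vector space. It is unique as a map on the symmetric algebra, and as a total function
  it is pinned down by the value \<open>0\<close> outside.
\<close>

definition leibniz_ext ::
  "('k::field \<Rightarrow> 'q::ab_group_add \<Rightarrow> 'q) \<Rightarrow> ('q \<Rightarrow> 'q \<Rightarrow> 'q) \<Rightarrow>
   (('q \<Rightarrow> 'k) \<Rightarrow> 'k) \<Rightarrow> (('q \<Rightarrow> 'k) \<Rightarrow> 'k) \<Rightarrow> (('q \<Rightarrow> 'k) \<Rightarrow> 'k)"
  where "leibniz_ext sc b = (THE P. biderivation sc P \<and>
    (\<forall>x y. P (sym_of sc x) (sym_of sc y) = sym_of sc (b x y)) \<and>
    (\<forall>f g. f \<notin> Sym sc \<or> g \<notin> Sym sc \<longrightarrow> P f g = 0))"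

definition poisson_isomorphic ::
  "('k::field \<Rightarrow> 'q::ab_group_add \<Rightarrow> 'q) \<Rightarrow>
   ((('q \<Rightarrow> 'k) \<Rightarrow> 'k) \<Rightarrow> (('q \<Rightarrow> 'k) \<Rightarrow> 'k) \<Rightarrow> (('q \<Rightarrow> 'k) \<Rightarrow> 'k)) \<Rightarrow>
   ((('q \<Rightarrow> 'k) \<Rightarrow> 'k) \<Rightarrow> (('q \<Rightarrow> 'k) \<Rightarrow> 'k) \<Rightarrow> (('q \<Rightarrow> 'k) \<Rightarrow> 'k)) \<Rightarrow> bool"
  where "poisson_isomorphic sc P P' \<longleftrightarrow> poisson_bracket sc P \<and> poisson_bracket sc P' \<and>
    (\<exists>T. bij_betw T (Sym sc) (Sym sc) \<and>
      (\<forall>f\<in>Sym sc. \<forall>g\<in>Sym sc.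
         T (f + g) = T f + T g \<and> T (f * g) = T f * T g \<and> T (P f g) = P' (T f) (T g)) \<and>
      (\<forall>c. \<forall>f\<in>Sym sc. T (fscale c f) = fscale c (T f)))"


section \<open>Representations of the multiplicative group, gradings and contractions\<close>

text \<open>Only the values at \<open>s \<noteq> 0\<close> of a family indexed by the field are meaningful here.\<close>

definition poly_rep ::
  "('k::field \<Rightarrow> 'q::ab_group_add \<Rightarrow> 'q) \<Rightarrow> ('k \<Rightarrow> 'q \<Rightarrow> 'q) \<Rightarrow> bool"
  where "poly_rep sc \<phi> \<longleftrightarrow>
    (\<forall>s. s \<noteq> 0 \<longrightarrow> Vector_Spaces.linear sc sc (\<phi> s) \<and> bij (\<phi> s)) \<and>
    (\<forall>s t. s \<noteq> 0 \<longrightarrow> t \<noteq> 0 \<longrightarrow> \<phi> (s * t) = \<phi> s \<circ> \<phi> t) \<and>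
    (\<forall>B. finite_dimensional_vector_space sc B \<longrightarrow>
       (\<forall>b\<in>B. \<forall>b'\<in>B. \<exists>p :: 'k poly. \<forall>s. s \<noteq> 0 \<longrightarrow>
          module.representation sc B (\<phi> s b) b' = poly p s))"

definition lie_aut_of_order ::
  "('k::field \<Rightarrow> 'q::ab_group_add \<Rightarrow> 'q) \<Rightarrow> ('q \<Rightarrow> 'q \<Rightarrow> 'q) \<Rightarrow> ('q \<Rightarrow> 'q) \<Rightarrow> nat \<Rightarrow> bool"
  where "lie_aut_of_order sc br \<theta> m \<longleftrightarrow> lie_iso sc br br \<theta> \<and>
    0 < m \<and> \<theta> ^^ m = id \<and> (\<forall>k. 0 < k \<and> k < m \<longrightarrow> \<theta> ^^ k \<noteq> id)"

definition primitive_root_of_unity :: "nat \<Rightarrow> 'k::field \<Rightarrow> bool"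
  where "primitive_root_of_unity m \<zeta> \<longleftrightarrow>
    0 < m \<and> \<zeta> ^ m = 1 \<and> (\<forall>k. 0 < k \<and> k < m \<longrightarrow> \<zeta> ^ k \<noteq> 1)"

definition graded_part ::
  "('k::field \<Rightarrow> 'q::ab_group_add \<Rightarrow> 'q) \<Rightarrow> ('q \<Rightarrow> 'q) \<Rightarrow> 'k \<Rightarrow> nat \<Rightarrow> 'q set"
  where "graded_part sc \<theta> \<zeta> j = {x. \<theta> x = sc (\<zeta> ^ j) x}"

definition twisted_bracket ::
  "('q \<Rightarrow> 'q \<Rightarrow> 'q) \<Rightarrow> ('k \<Rightarrow> 'q \<Rightarrow> 'q) \<Rightarrow> 'k \<Rightarrow> 'q \<Rightarrow> 'q \<Rightarrow> 'q"
  where "twisted_bracket br \<phi> s x y = inv_into UNIV (\<phi> s) (br (\<phi> s x) (\<phi> s y))"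

text \<open>
  The algebraic limit at \<open>0\<close>: the curve agrees for \<open>s \<noteq> 0\<close> with a polynomial in \<open>s\<close>
  with vector coefficients, whose value at \<open>s = 0\<close> is the limit.
\<close>

definition has_zero_limit ::
  "('k::field \<Rightarrow> 'q::ab_group_add \<Rightarrow> 'q) \<Rightarrow> ('k \<Rightarrow> 'q) \<Rightarrow> 'q \<Rightarrow> bool"
  where "has_zero_limit sc \<gamma> l \<longleftrightarrow>
    (\<exists>n c. (\<forall>s. s \<noteq> 0 \<longrightarrow> \<gamma> s = (\<Sum>i\<le>n. sc (s ^ i) (c i))) \<and> l = c 0)"

definition zero_limit :: "('k::field \<Rightarrow> 'q::ab_group_add \<Rightarrow> 'q) \<Rightarrow> ('k \<Rightarrow> 'q) \<Rightarrow> 'q"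
  where "zero_limit sc \<gamma> = (THE l. has_zero_limit sc \<gamma> l)"

end

theory Submission
  imports Defs
begin

text \<open>
  The automorphism decomposes the Lie algebra into homogeneous components of degrees
  \<open>0, \<dots>, m - 1\<close>, and the bracket of elements of degrees \<open>i\<close> and \<open>j\<close> has degree
  \<open>(i + j) mod m\<close>. Twisting by \<open>\<phi> s\<close> multiplies this bracket by \<open>s ^ (i + j)\<close> and divides it by
  \<open>s ^ ((i + j) mod m)\<close>. The quotient is \<open>1\<close> if \<open>i + j < m\<close> and \<open>s ^ m\<close> otherwise. So if
  \<open>br_zero\<close> collects the brackets without a carry and \<open>br_infinity\<close> those with a carry, the twisted
  bracket is the pencil \<open>br_zero + s ^ m * br_infinity\<close> (lemma \<open>twisted_bracket_eq\<close>), and its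
  limit at \<open>s = 0\<close> is \<open>br_zero\<close>. At \<open>s = 1\<close> the pencil is the original bracket, which identifies
  \<open>br_infinity\<close> as the difference.

  For \<open>s \<noteq> 0\<close> the twisted bracket is carried to the original one by \<open>\<phi> s\<close>, so it is a Lie
  bracket. The axioms of a Lie algebra are polynomial in \<open>s\<close>, and a polynomial curve that vanishes
  for all \<open>s \<noteq> 0\<close> has zero coefficients. The extreme coefficients are the axioms for \<open>br_zero\<close> and
  for \<open>br_infinity\<close> (lemma \<open>lie_pencil_ends\<close>). Twisting by \<open>\<psi> s\<close>, which is \<open>s ^ m\<close> times the
  inverse of \<open>\<phi> s\<close>, amounts to replacing \<open>s\<close> by its inverse and multiplying the bracket by
  \<open>s ^ m\<close>. The pencil becomes \<open>br_infinity + s ^ m * br_zero\<close>, with limit \<open>br_infinity\<close>.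

  What remains is the passage from bilinear operations on the vector space to brackets on the
  symmetric algebra. The extension by the Leibniz rule exists by the classical formula with partial
  derivatives (lemma \<open>leibniz_extension_exists\<close>). It is unique because derivations are determined
  by their values on generators (lemma \<open>biderivation_eqI\<close>). Uniqueness makes the extension
  additive and homogeneous in the bilinear operation, and compatible with isomorphisms. The Jacobi
  identity passes to the extension because the Jacobiator is a derivation in each argument (lemma
  \<open>linear_poisson_bracketI\<close>).
\<close>

section \<open>Polynomial curves and limits at zero\<close>

locale char0_vector_space = vector_space sc
  for sc :: "'k::field_char_0 \<Rightarrow> 'q::ab_group_add \<Rightarrow> 'q"
begin

lemma linear_iff_maps:
  "Vector_Spaces.linear sc sc F \<longleftrightarrow> (\<forall>x y. F (x + y) = F x + F y) \<and> (\<forall>c x. F (sc c x) = sc c (F x))"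
  unfolding Vector_Spaces.linear_iff using vector_space_axioms by blast

lemma linear_sum:
  assumes "Vector_Spaces.linear sc sc F" shows "F (\<Sum>i\<in>I. X i) = (\<Sum>i\<in>I. F (X i))"
proof -
  have F: "F (x + y) = F x + F y" "F (sc c x) = sc c (F x)" for x y c
    using assms unfolding linear_iff_maps by blast+
  have "F 0 = 0" using F(2)[of 0 0] by simp
  then show ?thesis by (induction I rule: infinite_finite_induct) (simp_all add: F)
qed

text \<open>Read in coordinates with respect to a basis, the curve is a tuple of scalar polynomials,
  each of which has infinitely many roots.\<close>

lemma vanishing_curve_imp_coeffs_zero:
  fixes c :: "nat \<Rightarrow> 'q"
  assumes van: "\<And>s. s \<noteq> 0 \<Longrightarrow> (\<Sum>i\<le>n. sc (s ^ i) (c i)) = 0" and "i \<le> n"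
  shows "c i = 0"
proof -
  define B where "B = extend_basis {}"
  have indB: "independent B" and spanB: "span B = UNIV"
    unfolding B_def by (auto simp: independent_extend_basis independent_empty)
  have "representation B (c i) b = 0" for b
  proof -
    define p where "p = (\<Sum>j\<le>n. monom (representation B (c j) b) j)"
    have "poly p s = representation B (\<Sum>j\<le>n. sc (s ^ j) (c j)) b" for s
      unfolding p_def poly_sum poly_monom
      by (simp add: representation_sum representation_scale indB spanB mult.commute)
    then have "UNIV - {0} \<subseteq> {s. poly p s = 0}"
      using van by (auto simp: representation_zero)
    moreover have "infinite (UNIV - {0 :: 'k})"
      by (simp add: infinite_UNIV_char_0)
    ultimately have "p = 0"
      using poly_roots_finite finite_subset by blast
    then have "coeff p i = 0" by simp
    then show ?thesis
      using \<open>i \<le> n\<close> unfolding p_def by (simp add: coeff_sum)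
  qed
  then have "representation B (c i) = representation B 0"
    by (simp add: fun_eq_iff representation_zero)
  moreover have "(\<Sum>b\<in>{b. representation B v b \<noteq> 0}. sc (representation B v b) b) = v" for v
    using indB spanB by (simp add: sum_nonzero_representation_eq)
  ultimately show ?thesis by metis
qed

text \<open>Two polynomial expressions of one curve, padded to a common length, have the same
  coefficients by the preceding lemma; in particular the algebraic limit is well defined.\<close>

lemma zero_limit_unique:
  assumes "has_zero_limit sc \<gamma> l" and "has_zero_limit sc \<gamma> l'"
  shows "l = l'"
proof -
  obtain n c where c: "\<And>s. s \<noteq> 0 \<Longrightarrow> \<gamma> s = (\<Sum>i\<le>n. sc (s ^ i) (c i))" and l: "l = c 0"
    using assms(1) unfolding has_zero_limit_def by blast
  obtain n' c' where c': "\<And>s. s \<noteq> 0 \<Longrightarrow> \<gamma> s = (\<Sum>i\<le>n'. sc (s ^ i) (c' i))" and l': "l' = c' 0"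
    using assms(2) unfolding has_zero_limit_def by blast
  have pad: "(\<Sum>i\<le>k. sc (s ^ i) (d i)) = (\<Sum>i\<le>N. sc (s ^ i) (if i \<le> k then d i else 0))"
    if "k \<le> N" for k N s and d :: "nat \<Rightarrow> 'q"
  proof -
    have "(\<Sum>i\<le>k. sc (s ^ i) (d i)) = (\<Sum>i\<le>k. sc (s ^ i) (if i \<le> k then d i else 0))"
      by simp
    also have "\<dots> = (\<Sum>i\<le>N. sc (s ^ i) (if i \<le> k then d i else 0))"
      using that by (intro sum.mono_neutral_left) auto
    finally show ?thesis .
  qed
  define N where "N = max n n'"
  define e where "e i = (if i \<le> n then c i else 0) - (if i \<le> n' then c' i else 0)" for i
  have "(\<Sum>i\<le>N. sc (s ^ i) (e i)) = 0" if "s \<noteq> 0" for s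
    unfolding e_def scale_right_diff_distrib sum_subtractf
    using pad[of n N s c] pad[of n' N s c'] c[OF that] c'[OF that] by (simp add: N_def)
  then have "e 0 = 0"
    by (rule vanishing_curve_imp_coeffs_zero) simp_all
  then show ?thesis by (simp add: e_def l l')
qed

lemma zero_limit_eq: "has_zero_limit sc \<gamma> l \<Longrightarrow> zero_limit sc \<gamma> = l"
  unfolding zero_limit_def using zero_limit_unique by blast

lemma has_zero_limit_binomial:
  assumes "0 < m" and "\<And>s. s \<noteq> 0 \<Longrightarrow> \<gamma> s = u + sc (s ^ m) v"
  shows "has_zero_limit sc \<gamma> u"
  unfolding has_zero_limit_def
proof (intro exI conjI allI impI)
  define c where "c i = (if i = 0 then u else 0) + (if i = m then v else 0)" for i
  show "\<gamma> s = (\<Sum>i\<le>m. sc (s ^ i) (c i))" if "s \<noteq> 0" for s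
    using that unfolding c_def scale_right_distrib sum.distrib
    by (simp add: assms if_distrib cong: if_cong)
  show "u = c 0" using assms(1) by (simp add: c_def)
qed


section \<open>Pencils of Lie brackets\<close>

definition bilinear_op :: "('q \<Rightarrow> 'q \<Rightarrow> 'q) \<Rightarrow> bool"
  where "bilinear_op b \<longleftrightarrow>
    (\<forall>y. Vector_Spaces.linear sc sc (\<lambda>x. b x y)) \<and> (\<forall>x. Vector_Spaces.linear sc sc (b x))"

lemma bilinear_op_simps:
  assumes "bilinear_op b"
  shows "b (x + x') y = b x y + b x' y" and "b x (y + y') = b x y + b x y'"
    and "b (sc c x) y = sc c (b x y)" and "b x (sc c y) = sc c (b x y)"
  using assms unfolding bilinear_op_def linear_iff_maps by blast+

lemma bilinear_op_sum:
  assumes "bilinear_op b"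
  shows "b (\<Sum>i\<in>I. X i) y = (\<Sum>i\<in>I. b (X i) y)" and "b x (\<Sum>i\<in>I. Y i) = (\<Sum>i\<in>I. b x (Y i))"
proof -
  have z: "b 0 y = 0" "b x 0 = 0" for x y
    using bilinear_op_simps(3)[OF assms, of 0 0 y] bilinear_op_simps(4)[OF assms, of x 0 0]
    by simp_all
  show "b (\<Sum>i\<in>I. X i) y = (\<Sum>i\<in>I. b (X i) y)" "b x (\<Sum>i\<in>I. Y i) = (\<Sum>i\<in>I. b x (Y i))"
    by (induction I rule: infinite_finite_induct; simp add: z bilinear_op_simps[OF assms])+
qed

lemma lie_algebra_iff:
  "lie_algebra sc b \<longleftrightarrow> bilinear_op b \<and> (\<forall>x. b x x = 0) \<and>
     (\<forall>x y z. b x (b y z) + b y (b z x) + b z (b x y) = 0)"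
  unfolding lie_algebra_def lie_algebra_axioms_def bilinear_op_def
  using vector_space_axioms by blast

text \<open>Alternation and the Jacobi identity are polynomial conditions of degree at most two in
  \<open>s ^ m\<close>. Their extreme coefficients are the conditions for \<open>a\<close> and for \<open>b\<close>; the
  middle coefficient of the Jacobi identity says that the two brackets are compatible.\<close>

lemma lie_pencil_ends:
  assumes a: "bilinear_op a" and b: "bilinear_op b" and "0 < m"
    and lie: "\<And>s. s \<noteq> 0 \<Longrightarrow> lie_algebra sc (\<lambda>x y. a x y + sc (s ^ m) (b x y))"
  shows "lie_algebra sc a" and "lie_algebra sc b"
proof -
  have ends: "u = 0 \<and> v = 0 \<and> w = 0"
    if "\<And>s. s \<noteq> 0 \<Longrightarrow> u + sc (s ^ m) v + sc (s ^ (2 * m)) w = 0" for u v w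
  proof -
    define c where "c i = (if i = 0 then u else 0) + (if i = m then v else 0)
        + (if i = 2 * m then w else 0)" for i
    have "(\<Sum>i\<le>2 * m. sc (s ^ i) (c i)) = 0" if "s \<noteq> 0" for s
      using that \<open>\<And>s. s \<noteq> 0 \<Longrightarrow> u + sc (s ^ m) v + sc (s ^ (2 * m)) w = 0\<close>
      unfolding c_def scale_right_distrib sum.distrib
      by (simp add: if_distrib cong: if_cong)
    then have "c 0 = 0" "c m = 0" "c (2 * m) = 0"
      using vanishing_curve_imp_coeffs_zero[where n = "2 * m" and c = c] by simp_all
    then show ?thesis using \<open>0 < m\<close> by (simp add: c_def)
  qed
  have alt: "a x x = 0 \<and> b x x = 0 \<and> (0 :: 'q) = 0" for x
    by (rule ends) (use lie in \<open>simp add: lie_algebra_iff\<close>)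
  have jac: "a x (a y z) + a y (a z x) + a z (a x y) = 0 \<and>
      a x (b y z) + b x (a y z) + a y (b z x) + b y (a z x) + a z (b x y) + b z (a x y) = 0 \<and>
      b x (b y z) + b y (b z x) + b z (b x y) = 0" for x y z
  proof (rule ends)
    fix s :: 'k assume "s \<noteq> 0"
    then have J: "(\<lambda>x y. a x y + sc (s ^ m) (b x y)) x (a y z + sc (s ^ m) (b y z))
      + (\<lambda>x y. a x y + sc (s ^ m) (b x y)) y (a z x + sc (s ^ m) (b z x))
      + (\<lambda>x y. a x y + sc (s ^ m) (b x y)) z (a x y + sc (s ^ m) (b x y)) = 0"
      using lie unfolding lie_algebra_iff by blast
    show "a x (a y z) + a y (a z x) + a z (a x y)
      + sc (s ^ m) (a x (b y z) + b x (a y z) + a y (b z x) + b y (a z x) + a z (b x y) + b z (a x y))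
      + sc (s ^ (2 * m)) (b x (b y z) + b y (b z x) + b z (b x y)) = 0"
      using J unfolding mult_2 power_add
      by (simp add: bilinear_op_simps[OF a] bilinear_op_simps[OF b] scale_right_distrib ac_simps)
  qed
  show "lie_algebra sc a" "lie_algebra sc b"
    using alt jac a b by (auto simp: lie_algebra_iff)
qed


section \<open>Derivations of the symmetric algebra\<close>

abbreviation S :: "(('q \<Rightarrow> 'k) \<Rightarrow> 'k) set" where "S \<equiv> Sym sc"

abbreviation U :: "('q \<Rightarrow> 'k) set" where "U \<equiv> dual_space sc"

definition sym_one :: "('q \<Rightarrow> 'k) \<Rightarrow> 'k"
  where "sym_one = (\<lambda>\<xi>. if \<xi> \<in> U then 1 else 0)"

lemma dual_space_iff:
  "\<xi> \<in> U \<longleftrightarrow> (\<forall>x y. \<xi> (x + y) = \<xi> x + \<xi> y) \<and> (\<forall>c x. \<xi> (sc c x) = c * \<xi> x)"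
proof -
  have "vector_space ((*) :: 'k \<Rightarrow> 'k \<Rightarrow> 'k)"
    by unfold_locales (simp_all add: algebra_simps)
  then show ?thesis
    unfolding dual_space_def Vector_Spaces.linear_iff using vector_space_axioms by blast
qed

lemma dual_space_sum:
  assumes "\<xi> \<in> U" shows "\<xi> (\<Sum>i\<in>I. X i) = (\<Sum>i\<in>I. \<xi> (X i))"
proof -
  have "\<xi> 0 = 0" using assms unfolding dual_space_iff by (metis scale_zero_left mult_zero_left)
  then show ?thesis
    using assms by (induction I rule: infinite_finite_induct) (simp_all add: dual_space_iff)
qed

lemma Sym_outside: "f \<in> S \<Longrightarrow> \<xi> \<notin> U \<Longrightarrow> f \<xi> = 0"
  unfolding Sym_def by (induction rule: poly_funs.induct) auto

lemma sym_of_in_Sym: "sym_of sc x \<in> S"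
  unfolding Sym_def sym_of_def by (rule poly_funs.gen[of "\<lambda>\<xi>. \<xi> x"]) simp

lemma fscale_sym_one_in_Sym: "fscale c sym_one \<in> S"
proof -
  have "fscale c sym_one = (\<lambda>\<xi>. if \<xi> \<in> U then c else 0)"
    by (auto simp: fscale_def sym_one_def)
  then show ?thesis unfolding Sym_def by (simp add: poly_funs.const)
qed

lemma Sym_add: "f \<in> S \<Longrightarrow> g \<in> S \<Longrightarrow> f + g \<in> S"
  unfolding Sym_def by (rule poly_funs.add)

lemma Sym_mult: "f \<in> S \<Longrightarrow> g \<in> S \<Longrightarrow> f * g \<in> S"
  unfolding Sym_def by (rule poly_funs.mult)

lemma sym_one_mult: "f \<in> S \<Longrightarrow> sym_one * f = f"
  by (auto simp: fun_eq_iff sym_one_def Sym_outside)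

lemma fscale_mult_left: "fscale c f * g = fscale c (f * g)"
  and fscale_mult_right: "f * fscale c g = fscale c (f * g)"
  and fscale_add: "fscale c (f + g) = fscale c f + fscale c g"
  and fscale_diff: "fscale c (f - g) = fscale c f - fscale c g"
  and fscale_zero: "fscale c 0 = 0"
  and fscale_one: "fscale 1 f = f"
  and fscale_uminus_one: "fscale (- 1) f = - f"
  for f g :: "('q \<Rightarrow> 'k) \<Rightarrow> 'k"
  by (auto simp: fscale_def fun_eq_iff algebra_simps)

lemma Sym_fscale: assumes "f \<in> S" shows "fscale c f \<in> S"
proof -
  have "fscale c f = fscale c sym_one * f"
    by (simp add: fscale_mult_left sym_one_mult assms)
  then show ?thesis by (simp add: Sym_mult fscale_sym_one_in_Sym assms)
qed

lemma Sym_one: "sym_one \<in> S" and Sym_zero: "0 \<in> S"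
proof -
  show "sym_one \<in> S" using fscale_sym_one_in_Sym[of 1] by (simp add: fscale_one)
  have "fscale 0 sym_one = 0" by (simp add: fscale_def fun_eq_iff)
  then show "0 \<in> S" using fscale_sym_one_in_Sym[of 0] by simp
qed

lemma Sym_diff: "f \<in> S \<Longrightarrow> g \<in> S \<Longrightarrow> f - g \<in> S"
  using Sym_add[of f "fscale (- 1) g"] Sym_fscale[of g "- 1"] by (simp add: fscale_uminus_one)

lemma Sym_sum: "(\<And>i. i \<in> I \<Longrightarrow> F i \<in> S) \<Longrightarrow> (\<Sum>i\<in>I. F i) \<in> S"
  by (induction I rule: infinite_finite_induct) (simp_all add: Sym_zero Sym_add)

lemmas Sym_intros = sym_of_in_Sym fscale_sym_one_in_Sym Sym_add Sym_mult Sym_fscale Sym_one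
  Sym_zero Sym_diff Sym_sum

lemma Sym_induct [consumes 1, case_names const gen add mult]:
  assumes "f \<in> S"
    and const: "\<And>c. Q (fscale c sym_one)"
    and gen: "\<And>x. Q (sym_of sc x)"
    and add: "\<And>f g. f \<in> S \<Longrightarrow> g \<in> S \<Longrightarrow> Q f \<Longrightarrow> Q g \<Longrightarrow> Q (f + g)"
    and mult: "\<And>f g. f \<in> S \<Longrightarrow> g \<in> S \<Longrightarrow> Q f \<Longrightarrow> Q g \<Longrightarrow> Q (f * g)"
  shows "Q f"
  using assms(1) unfolding Sym_def
proof (induction rule: poly_funs.induct)
  case (const c)
  have "fscale c sym_one = (\<lambda>\<xi>. if \<xi> \<in> U then c else 0)"
    by (auto simp: fscale_def sym_one_def)
  then show ?case using assms(2)[of c] by simp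
next
  case (gen g)
  then obtain x where "g = (\<lambda>\<xi>. \<xi> x)" by blast
  then show ?case using assms(3)[of x] unfolding sym_of_def by (simp cong: if_cong)
next
  case (add f g)
  then show ?case using assms(4)[of f g] unfolding Sym_def plus_fun_def by blast
next
  case (mult f g)
  then show ?case using assms(5)[of f g] unfolding Sym_def times_fun_def by blast
qed

text \<open>A biderivation is a derivation in each argument, so identities between brackets on the
  symmetric algebra are proved one argument at a time, by comparing two derivations on the
  generators.\<close>

definition derivation :: "((('q \<Rightarrow> 'k) \<Rightarrow> 'k) \<Rightarrow> (('q \<Rightarrow> 'k) \<Rightarrow> 'k)) \<Rightarrow> bool"
  where "derivation d \<longleftrightarrow>
    (\<forall>f\<in>S. d f \<in> S) \<and>
    (\<forall>f\<in>S. \<forall>g\<in>S. d (f + g) = d f + d g) \<and>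
    (\<forall>c. \<forall>f\<in>S. d (fscale c f) = fscale c (d f)) \<and>
    (\<forall>f\<in>S. \<forall>g\<in>S. d (f * g) = f * d g + d f * g)"

lemma derivationI:
  assumes "\<And>f. f \<in> S \<Longrightarrow> d f \<in> S"
    and "\<And>f g. f \<in> S \<Longrightarrow> g \<in> S \<Longrightarrow> d (f + g) = d f + d g"
    and "\<And>c f. f \<in> S \<Longrightarrow> d (fscale c f) = fscale c (d f)"
    and "\<And>f g. f \<in> S \<Longrightarrow> g \<in> S \<Longrightarrow> d (f * g) = f * d g + d f * g"
  shows "derivation d"
  unfolding derivation_def using assms by blast

lemma derivationD:
  assumes "derivation d" and "f \<in> S"
  shows "d f \<in> S" and "g \<in> S \<Longrightarrow> d (f + g) = d f + d g"
    and "d (fscale c f) = fscale c (d f)" and "g \<in> S \<Longrightarrow> d (f * g) = f * d g + d f * g"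
  using assms unfolding derivation_def by blast+

lemma derivation_cong:
  assumes "derivation d" and "\<And>f. f \<in> S \<Longrightarrow> d' f = d f"
  shows "derivation d'"
  by (rule derivationI) (simp_all add: assms Sym_intros derivationD[OF assms(1)])

lemma derivation_add:
  assumes "derivation d" and "derivation d'"
  shows "derivation (\<lambda>f. d f + d' f)"
  by (rule derivationI)
    (simp_all add: derivationD[OF assms(1)] derivationD[OF assms(2)] Sym_intros fscale_add algebra_simps)

lemma derivation_diff:
  assumes "derivation d" and "derivation d'"
  shows "derivation (\<lambda>f. d f - d' f)"
  by (rule derivationI)
    (simp_all add: derivationD[OF assms(1)] derivationD[OF assms(2)] Sym_intros fscale_diff algebra_simps)

lemma derivation_zero: "derivation (\<lambda>f. 0)"
  by (rule derivationI) (simp_all add: Sym_intros fscale_zero)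

lemma derivation_mult:
  assumes "h \<in> S" and "derivation d"
  shows "derivation (\<lambda>f. h * d f)"
  by (rule derivationI)
    (simp_all add: assms(1) derivationD[OF assms(2)] Sym_intros fscale_mult_right algebra_simps)

lemma derivation_sum:
  "(\<And>i. i \<in> I \<Longrightarrow> derivation (D i)) \<Longrightarrow> derivation (\<lambda>f. \<Sum>i\<in>I. D i f)"
  by (induction I rule: infinite_finite_induct) (simp_all add: derivation_zero derivation_add)

lemma derivation_commutator:
  assumes "derivation d" and "derivation d'"
  shows "derivation (\<lambda>f. d (d' f) - d' (d f))"
  by (rule derivationI)
    (simp_all add: derivationD[OF assms(1)] derivationD[OF assms(2)] Sym_intros fscale_diff algebra_simps)

lemma derivation_eqI:
  assumes d: "derivation d" and d': "derivation d'"
    and gens: "\<And>x. d (sym_of sc x) = d' (sym_of sc x)"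
    and "f \<in> S"
  shows "d f = d' f"
  using \<open>f \<in> S\<close>
proof (induction rule: Sym_induct)
  case (const c)
  \<comment> \<open>The unit is idempotent, so the Leibniz rule gives \<open>d 1 = 2 * d 1\<close>.\<close>
  have unit: "D sym_one = 0" if "derivation D" for D
  proof -
    have "D sym_one = D (sym_one * sym_one)" by (simp add: sym_one_mult Sym_one)
    also have "\<dots> = D sym_one + D sym_one"
      unfolding derivationD(4)[OF that Sym_one Sym_one] mult.commute[of "D sym_one"]
      by (simp add: sym_one_mult derivationD(1)[OF that Sym_one])
    finally show ?thesis by simp
  qed
  show ?case by (simp add: derivationD[OF d] derivationD[OF d'] Sym_one unit[OF d] unit[OF d'])
next
  case (gen x)
  then show ?case by (rule gens)
next
  case (add f g)
  show ?case
    unfolding derivationD(2)[OF d add(1,2)] derivationD(2)[OF d' add(1,2)] add(3,4) ..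
next
  case (mult f g)
  show ?case
    unfolding derivationD(4)[OF d mult(1,2)] derivationD(4)[OF d' mult(1,2)] mult(3,4) ..
qed

lemma biderivation_iff:
  "biderivation sc P \<longleftrightarrow> (\<forall>h\<in>S. derivation (P h)) \<and> (\<forall>h\<in>S. derivation (\<lambda>f. P f h))"
proof (intro iffI conjI ballI)
  fix h assume P: "biderivation sc P" and h: "h \<in> S"
  show "derivation (P h)" "derivation (\<lambda>f. P f h)"
    by (rule derivationI; use P h in \<open>simp add: biderivation_def\<close>)+
next
  assume "(\<forall>h\<in>S. derivation (P h)) \<and> (\<forall>h\<in>S. derivation (\<lambda>f. P f h))"
  then have l: "\<And>h. h \<in> S \<Longrightarrow> derivation (P h)" and r: "\<And>h. h \<in> S \<Longrightarrow> derivation (\<lambda>f. P f h)"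
    by blast+
  show "biderivation sc P"
    unfolding biderivation_def by (simp add: derivationD[OF l] derivationD[OF r])
qed

text \<open>The Leibniz rule determines the bracket by its values on pairs of generators. This
  uniqueness also yields skew-symmetry, additivity of the extension in the bracket, and
  equivariance, each by comparing two biderivations on generators.\<close>

lemma biderivation_eqI:
  assumes P: "biderivation sc P" and Q: "biderivation sc Q"
    and gens: "\<And>x y. P (sym_of sc x) (sym_of sc y) = Q (sym_of sc x) (sym_of sc y)"
    and "f \<in> S" and "g \<in> S"
  shows "P f g = Q f g"
proof -
  have der: "derivation (P h)" "derivation (\<lambda>f. P f h)" "derivation (Q h)" "derivation (\<lambda>f. Q f h)"
    if "h \<in> S" for h
    using P Q that unfolding biderivation_iff by blast+
  have "P (sym_of sc x) g = Q (sym_of sc x) g" for x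
    using der(1,3)[OF sym_of_in_Sym] gens \<open>g \<in> S\<close> by (rule derivation_eqI)
  with der(2,4)[OF \<open>g \<in> S\<close>] show ?thesis
    using \<open>f \<in> S\<close> by (rule derivation_eqI)
qed


section \<open>Linear Poisson brackets\<close>

text \<open>Skew-symmetry and the Jacobi identity spread from the generators to all of the symmetric
  algebra. For the second, skew-symmetry turns \<open>h \<mapsto> P f (P g h) + P g (P h f) + P h (P f g)\<close> into
  \<open>[P f, P g] - P (P f g)\<close>, which is a derivation because a commutator of derivations is one.\<close>

lemma linear_poisson_bracketI:
  assumes lie: "lie_algebra sc b" and P: "biderivation sc P"
    and gens: "\<And>x y. P (sym_of sc x) (sym_of sc y) = sym_of sc (b x y)"
  shows "linear_poisson_bracket sc P"
proof -
  have der: "derivation (P h)" "derivation (\<lambda>f. P f h)" if "h \<in> S" for h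
    using P that by (auto simp: biderivation_iff)
  have mem: "P f g \<in> S" if "f \<in> S" "g \<in> S" for f g
    using derivationD(1)[OF der(1)] that by blast
  have bl: "bilinear_op b" and alt: "b x x = 0"
    and jac: "b x (b y z) + b y (b z x) + b z (b x y) = 0" for x y z
    using lie by (auto simp: lie_algebra_iff)
  have antisym: "b x y = - b y x" for x y
    using alt[of x] alt[of y] alt[of "x + y"]
    by (simp add: bilinear_op_simps[OF bl] eq_neg_iff_add_eq_0 add.commute)
  have sym_add: "sym_of sc (x + y) = sym_of sc x + sym_of sc y"
    and sym_neg: "sym_of sc (- x) = - sym_of sc x" 
    and sym_zero: "sym_of sc 0 = 0" for x y
  proof -
    have ev: "\<xi> (x + y) = \<xi> x + \<xi> y" "\<xi> (- x) = - \<xi> x" "\<xi> 0 = 0" if "\<xi> \<in> U" for \<xi>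
    proof -
      have scal: "\<xi> (sc c x) = c * \<xi> x" for c x using that unfolding dual_space_iff by blast
      show "\<xi> (x + y) = \<xi> x + \<xi> y" using that unfolding dual_space_iff by blast
      show "\<xi> (- x) = - \<xi> x" "\<xi> 0 = 0" using scal[of "- 1" x] scal[of 0 x] by simp_all
    qed
    then show "sym_of sc (x + y) = sym_of sc x + sym_of sc y" "sym_of sc (- x) = - sym_of sc x"
      "sym_of sc 0 = 0"
      by (auto simp: sym_of_def fun_eq_iff)
  qed
  have skew: "P f g = - P g f" if "f \<in> S" "g \<in> S" for f g
  proof (rule biderivation_eqI[OF P _ _ that])
    have "derivation (\<lambda>f. fscale (-1) sym_one * D f)" if "derivation D" for D
      by (rule derivation_mult) (simp_all add: that Sym_intros)
    moreover have "fscale (-1) sym_one * f = - f" if "f \<in> S" for f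
      using that by (simp add: fscale_mult_left sym_one_mult fscale_uminus_one)
    ultimately have "derivation (\<lambda>f. - D f)" if "derivation D" for D
      by (rule_tac derivation_cong[of "\<lambda>f. fscale (-1) sym_one * D f"])
        (simp_all add: that derivationD(1)[OF that])
    then show "biderivation sc (\<lambda>f g. - P g f)"
      unfolding biderivation_iff using der by blast
    show "P (sym_of sc x) (sym_of sc y) = - P (sym_of sc y) (sym_of sc x)" for x y
      unfolding gens using antisym[of x y] sym_neg by metis
  qed
  have "P f f = 0" if "f \<in> S" for f
    using skew[OF that that] by (auto simp: fun_eq_iff)
  moreover
  define J where "J f g h = P f (P g h) - P g (P f h) - P (P f g) h" for f g h
  have Jder: "derivation (J f g)" if "f \<in> S" "g \<in> S" for f g
    unfolding J_def
    by (intro derivation_diff derivation_commutator der mem that)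
  have J: "P f (P g h) + P g (P h f) + P h (P f g) = J f g h" if "f \<in> S" "g \<in> S" "h \<in> S" for f g h
  proof -
    have "P g (P h f) = - P g (P f h)"
      using skew[OF that(3,1)] skew[OF that(2) mem[OF that(1,3)]] skew[OF _ that(2)] mem that
        derivationD(3)[OF der(1)[OF that(2)] mem[OF that(1,3)], of "- 1"]
      by (simp add: fscale_uminus_one)
    moreover have "P h (P f g) = - P (P f g) h"
      using skew mem that by blast
    ultimately show ?thesis by (simp add: J_def)
  qed
  have cyc: "J f g h = J h f g" if "f \<in> S" "g \<in> S" "h \<in> S" for f g h
    using J[OF that] J[OF that(3,1,2)] by (simp add: algebra_simps)
  \<comment> \<open>By cyclic symmetry it suffices that the Jacobiator is a derivation in its last argument:
    one argument after the other is moved there and released from the generators.\<close>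
  have vanish: "J f g h = 0" if "f \<in> S" "g \<in> S" "h \<in> S" "\<And>x. J f g (sym_of sc x) = 0" for f g h
    using derivation_eqI[OF Jder[OF that(1,2)] derivation_zero] that by blast
  have J3: "J (sym_of sc x) (sym_of sc y) h = 0" if "h \<in> S" for x y h
  proof (rule vanish)
    fix z
    show "J (sym_of sc x) (sym_of sc y) (sym_of sc z) = 0"
      using J[of "sym_of sc x" "sym_of sc y" "sym_of sc z"] jac[of x y z]
      by (simp add: Sym_intros gens flip: sym_add) (simp add: sym_zero)
  qed (simp_all add: that Sym_intros)
  have J2: "J h (sym_of sc x) g = 0" if "h \<in> S" "g \<in> S" for x g h
  proof (rule vanish)
    show "J h (sym_of sc x) (sym_of sc y) = 0" for y
      using cyc[of "sym_of sc x" "sym_of sc y" h] J3[OF that(1)] that by (simp add: Sym_intros)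
  qed (simp_all add: that Sym_intros)
  have "J g h f = 0" if "f \<in> S" "g \<in> S" "h \<in> S" for f g h
  proof (rule vanish)
    show "J g h (sym_of sc x) = 0" for x
      using cyc[of h "sym_of sc x" g] J2[of h g x] that by (simp add: Sym_intros)
  qed (simp_all add: that)
  ultimately show ?thesis
    unfolding linear_poisson_bracket_def poisson_bracket_def using P gens J by auto
qed


section \<open>Directional derivatives and the Leibniz extension\<close>

text \<open>A polynomial function restricted to the line \<open>\<xi> + t\<eta>\<close> is a polynomial in \<open>t\<close>,
  unique because the ground field is infinite.\<close>

definition line_point :: "('q \<Rightarrow> 'k) \<Rightarrow> ('q \<Rightarrow> 'k) \<Rightarrow> 'k \<Rightarrow> 'q \<Rightarrow> 'k"
  where "line_point \<xi> \<eta> t = (\<lambda>x. \<xi> x + t * \<eta> x)"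

definition line_poly :: "(('q \<Rightarrow> 'k) \<Rightarrow> 'k) \<Rightarrow> ('q \<Rightarrow> 'k) \<Rightarrow> ('q \<Rightarrow> 'k) \<Rightarrow> 'k poly"
  where "line_poly f \<xi> \<eta> = (THE p. \<forall>t. poly p t = f (line_point \<xi> \<eta> t))"

definition dir_deriv :: "('q \<Rightarrow> 'k) \<Rightarrow> (('q \<Rightarrow> 'k) \<Rightarrow> 'k) \<Rightarrow> ('q \<Rightarrow> 'k) \<Rightarrow> 'k"
  where "dir_deriv \<eta> f = (\<lambda>\<xi>. if \<xi> \<in> U then coeff (line_poly f \<xi> \<eta>) 1 else 0)"

lemma line_in_dual_space: "\<xi> \<in> U \<Longrightarrow> \<eta> \<in> U \<Longrightarrow> line_point \<xi> \<eta> t \<in> U"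
  unfolding dual_space_iff by (simp add: line_point_def algebra_simps)

lemma line_poly_eqI:
  assumes "\<And>t. poly p t = f (line_point \<xi> \<eta> t)"
  shows "line_poly f \<xi> \<eta> = p"
  unfolding line_poly_def
proof (rule the_equality)
  fix q assume "\<forall>t. poly q t = f (line_point \<xi> \<eta> t)"
  then have "poly q = poly p" by (simp add: assms fun_eq_iff)
  then show "q = p" by (simp only: poly_eq_poly_eq_iff)
qed (simp add: assms)

lemma line_poly_gens:
  assumes "\<xi> \<in> U" and "\<eta> \<in> U"
  shows "poly [:c:] t = fscale c sym_one (line_point \<xi> \<eta> t)"
    and "poly [:\<xi> x, \<eta> x:] t = sym_of sc x (line_point \<xi> \<eta> t)"
proof -
  have "line_point \<xi> \<eta> t x = \<xi> x + t * \<eta> x" by (simp add: line_point_def)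
  then show "poly [:c:] t = fscale c sym_one (line_point \<xi> \<eta> t)"
    "poly [:\<xi> x, \<eta> x:] t = sym_of sc x (line_point \<xi> \<eta> t)"
    using line_in_dual_space[OF assms, of t]
    by (simp_all add: fscale_def sym_one_def sym_of_def)
qed

lemma poly_line_poly:
  assumes "f \<in> S" and "\<xi> \<in> U" and "\<eta> \<in> U"
  shows "poly (line_poly f \<xi> \<eta>) t = f (line_point \<xi> \<eta> t)"
proof -
  have "\<exists>p. \<forall>t. poly p t = f (line_point \<xi> \<eta> t)"
    using assms(1)
  proof (induction rule: Sym_induct)
    case (const c)
    show ?case using line_poly_gens(1)[OF assms(2,3)] by blast
  next
    case (gen x)
    show ?case using line_poly_gens(2)[OF assms(2,3)] by blast
  next
    case (add f g)
    then obtain p q where "\<forall>t. poly p t = f (line_point \<xi> \<eta> t)" "\<forall>t. poly q t = g (line_point \<xi> \<eta> t)"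
      by blast
    then show ?case by (intro exI[of _ "p + q"]) simp
  next
    case (mult f g)
    then obtain p q where "\<forall>t. poly p t = f (line_point \<xi> \<eta> t)" "\<forall>t. poly q t = g (line_point \<xi> \<eta> t)"
      by blast
    then show ?case by (intro exI[of _ "p * q"]) simp
  qed
  then obtain p where p: "\<And>t. poly p t = f (line_point \<xi> \<eta> t)" by blast
  then show ?thesis using line_poly_eqI[of p f] by simp
qed

lemma coeff_0_line_poly:
  assumes "f \<in> S" and "\<xi> \<in> U" and "\<eta> \<in> U"
  shows "coeff (line_poly f \<xi> \<eta>) 0 = f \<xi>"
proof -
  have "line_point \<xi> \<eta> 0 = \<xi>" by (simp add: fun_eq_iff line_point_def)
  then show ?thesis using poly_line_poly[OF assms, of 0] by (simp add: poly_0_coeff_0)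
qed

lemma dir_deriv_rules:
  assumes "\<eta> \<in> U"
  shows "dir_deriv \<eta> (fscale c sym_one) = 0"
    and "dir_deriv \<eta> (sym_of sc x) = fscale (\<eta> x) sym_one"
    and "f \<in> S \<Longrightarrow> g \<in> S \<Longrightarrow> dir_deriv \<eta> (f + g) = dir_deriv \<eta> f + dir_deriv \<eta> g"
    and "f \<in> S \<Longrightarrow> g \<in> S \<Longrightarrow> dir_deriv \<eta> (f * g) = f * dir_deriv \<eta> g + dir_deriv \<eta> f * g"
    and "f \<in> S \<Longrightarrow> dir_deriv \<eta> (fscale c f) = fscale c (dir_deriv \<eta> f)"
proof -
  have "line_poly (fscale c sym_one) \<xi> \<eta> = [:c:]" if "\<xi> \<in> U" for \<xi>
    by (rule line_poly_eqI) (rule line_poly_gens[OF that assms])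
  then show "dir_deriv \<eta> (fscale c sym_one) = 0" by (simp add: dir_deriv_def fun_eq_iff)
  have "line_poly (sym_of sc x) \<xi> \<eta> = [:\<xi> x, \<eta> x:]" if "\<xi> \<in> U" for \<xi>
    by (rule line_poly_eqI) (rule line_poly_gens[OF that assms])
  then show "dir_deriv \<eta> (sym_of sc x) = fscale (\<eta> x) sym_one"
    by (simp add: dir_deriv_def fun_eq_iff fscale_def sym_one_def)
  assume f: "f \<in> S"
  have "line_poly (fscale c f) \<xi> \<eta> = smult c (line_poly f \<xi> \<eta>)" if "\<xi> \<in> U" for \<xi>
    by (rule line_poly_eqI) (simp add: poly_line_poly[OF f that assms] fscale_def)
  then show "dir_deriv \<eta> (fscale c f) = fscale c (dir_deriv \<eta> f)"
    by (simp add: dir_deriv_def fun_eq_iff fscale_def)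
  assume g: "g \<in> S"
  have "line_poly (f + g) \<xi> \<eta> = line_poly f \<xi> \<eta> + line_poly g \<xi> \<eta>" if "\<xi> \<in> U" for \<xi>
    by (rule line_poly_eqI) (simp add: poly_line_poly f g that assms)
  then show "dir_deriv \<eta> (f + g) = dir_deriv \<eta> f + dir_deriv \<eta> g"
    by (simp add: dir_deriv_def fun_eq_iff)
  have "line_poly (f * g) \<xi> \<eta> = line_poly f \<xi> \<eta> * line_poly g \<xi> \<eta>" if "\<xi> \<in> U" for \<xi>
    by (rule line_poly_eqI) (simp add: poly_line_poly f g that assms)
  then show "dir_deriv \<eta> (f * g) = f * dir_deriv \<eta> g + dir_deriv \<eta> f * g"
    by (simp add: dir_deriv_def fun_eq_iff coeff_mult coeff_0_line_poly f g assms)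
qed

lemma derivation_dir_deriv:
  assumes "\<eta> \<in> U"
  shows "derivation (dir_deriv \<eta>)"
proof (rule derivationI)
  show "dir_deriv \<eta> f \<in> S" if "f \<in> S" for f
    using that
  proof (induction rule: Sym_induct)
    case (const c)
    show ?case unfolding dir_deriv_rules(1)[OF assms] by (rule Sym_zero)
  next
    case (gen x)
    show ?case unfolding dir_deriv_rules(2)[OF assms] by (rule fscale_sym_one_in_Sym)
  next
    case (add f g)
    show ?case unfolding dir_deriv_rules(3)[OF assms add(1,2)] using add(3,4) by (rule Sym_add)
  next
    case (mult f g)
    show ?case unfolding dir_deriv_rules(4)[OF assms mult(1,2)]
      by (intro Sym_add Sym_mult mult)
  qed
qed (rule dir_deriv_rules[OF assms]; assumption)+

text \<open>In terms of a basis, the extension is the usual formula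
  \<open>\<Sum> [e, e'] * (\<partial>f/\<partial>e) * (\<partial>g/\<partial>e')\<close>, where \<open>\<partial>/\<partial>e\<close> is the derivative in the direction of the
  coordinate function of \<open>e\<close>, a point of the dual space. Finite dimension makes the sum finite.\<close>

lemma leibniz_extension_exists:
  assumes B: "finite_dimensional_vector_space sc B" and b: "bilinear_op b"
  shows "\<exists>P. biderivation sc P \<and> (\<forall>x y. P (sym_of sc x) (sym_of sc y) = sym_of sc (b x y)) \<and>
    (\<forall>f g. f \<notin> S \<or> g \<notin> S \<longrightarrow> P f g = 0)"
proof -
  interpret fd: finite_dimensional_vector_space sc B by (rule B)
  define coord where "coord e x = representation B x e" for e x
  have coordU: "coord e \<in> U" for e
    unfolding coord_def dual_space_iff
    by (simp add: fd.span_Basis fd.independent_Basis representation_add representation_scale)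
  have expand: "(\<Sum>e\<in>B. sc (coord e x) e) = x" for x
    unfolding coord_def
    by (rule sum_representation_eq)
      (simp_all add: fd.span_Basis fd.independent_Basis fd.finite_Basis)
  define R where "R f g = (\<Sum>e\<in>B. \<Sum>e'\<in>B.
      (sym_of sc (b e e') * dir_deriv (coord e') g) * dir_deriv (coord e) f)" for f g
  \<comment> \<open>Each form of the sum exhibits \<open>R\<close> as a combination of derivations in one of its
    arguments.\<close>
  have R_comm: "R f g = (\<Sum>e\<in>B. \<Sum>e'\<in>B.
      (sym_of sc (b e e') * dir_deriv (coord e) f) * dir_deriv (coord e') g)" for f g
    unfolding R_def by (simp only: mult.assoc mult.commute mult.left_commute)
  have Dmem: "dir_deriv (coord e) f \<in> S" if "f \<in> S" for e f
    by (rule derivationD(1)[OF derivation_dir_deriv[OF coordU] that])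
  have R1: "derivation (\<lambda>f. R f g)" if "g \<in> S" for g
    unfolding R_def
    by (intro derivation_sum derivation_mult Sym_mult sym_of_in_Sym Dmem that
        derivation_dir_deriv coordU)
  have R2: "derivation (R f)" if "f \<in> S" for f
    unfolding R_comm[abs_def]
    by (intro derivation_sum derivation_mult Sym_mult sym_of_in_Sym Dmem that
        derivation_dir_deriv coordU)
  define P where "P f g = (if f \<in> S \<and> g \<in> S then R f g else 0)" for f g
  have "biderivation sc P"
    unfolding biderivation_iff
  proof (intro conjI ballI)
    fix h assume h: "h \<in> S"
    show "derivation (P h)"
      by (rule derivation_cong[OF R2[OF h]]) (simp add: P_def h)
    show "derivation (\<lambda>f. P f h)"
      by (rule derivation_cong[OF R1[OF h]]) (simp add: P_def h)
  qed
  moreover have "P (sym_of sc x) (sym_of sc y) = sym_of sc (b x y)" for x y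
  proof
    fix \<xi>
    show "P (sym_of sc x) (sym_of sc y) \<xi> = sym_of sc (b x y) \<xi>"
    proof (cases "\<xi> \<in> U")
      case True
      have "b x y = b (\<Sum>e\<in>B. sc (coord e x) e) (\<Sum>e'\<in>B. sc (coord e' y) e')"
        by (simp only: expand)
      also have "\<dots> = (\<Sum>e\<in>B. \<Sum>e'\<in>B. sc (coord e x) (sc (coord e' y) (b e e')))"
        unfolding bilinear_op_sum(1)[OF b] bilinear_op_simps(3)[OF b]
        unfolding bilinear_op_sum(2)[OF b] bilinear_op_simps(4)[OF b] scale_sum_right ..
      finally have "\<xi> (b x y) = (\<Sum>e\<in>B. \<Sum>e'\<in>B. coord e x * (coord e' y * \<xi> (b e e')))"
        using True by (simp add: dual_space_sum[OF True] dual_space_iff mult.assoc)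
      moreover have ev: "(\<Sum>i\<in>I. F i) \<xi> = (\<Sum>i\<in>I. F i \<xi>)" for I :: "'q set" and F
        by (induction I rule: infinite_finite_induct) simp_all
      ultimately show ?thesis
        using True
        by (simp add: P_def sym_of_in_Sym R_def ev dir_deriv_rules(2)[OF coordU] fscale_def
            sym_one_def sym_of_def[of _ "b _ _"] mult_ac)
    next
      case False
      then show ?thesis
        by (simp add: Sym_outside sym_of_in_Sym derivationD(1)[OF R2] P_def)
    qed
  qed
  moreover have "\<forall>f g. f \<notin> S \<or> g \<notin> S \<longrightarrow> P f g = 0" by (simp add: P_def)
  ultimately show ?thesis by blast
qed

lemma leibniz_ext_eqI:
  assumes "biderivation sc P" and "\<And>x y. P (sym_of sc x) (sym_of sc y) = sym_of sc (b x y)"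
    and "\<And>f g. f \<notin> S \<or> g \<notin> S \<Longrightarrow> P f g = 0"
  shows "leibniz_ext sc b = P"
  unfolding leibniz_ext_def
proof (rule the_equality)
  fix Q assume Q: "biderivation sc Q \<and> (\<forall>x y. Q (sym_of sc x) (sym_of sc y) = sym_of sc (b x y)) \<and>
    (\<forall>f g. f \<notin> S \<or> g \<notin> S \<longrightarrow> Q f g = 0)"
  have bQ: "biderivation sc Q" using Q by blast
  have gens: "Q (sym_of sc x) (sym_of sc y) = P (sym_of sc x) (sym_of sc y)" for x y
    using Q assms(2) by metis
  have "Q f g = P f g" for f g
  proof (cases "f \<in> S \<and> g \<in> S")
    case True
    then show ?thesis using biderivation_eqI[OF bQ assms(1) gens, of f g] by simp
  next
    case False
    then have "Q f g = 0" "P f g = 0" using Q assms(3)[of f g] by blast+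
    then show ?thesis by (simp only:)
  qed
  then show "Q = P" by (simp only: fun_eq_iff[of Q P] fun_eq_iff[of "Q _"] simp_thms)
qed (use assms in blast)

lemma leibniz_ext_properties:
  assumes "fin_dim sc" and "bilinear_op b"
  shows "biderivation sc (leibniz_ext sc b)"
    and "leibniz_ext sc b (sym_of sc x) (sym_of sc y) = sym_of sc (b x y)"
    and "f \<notin> S \<or> g \<notin> S \<Longrightarrow> leibniz_ext sc b f g = 0"
proof -
  obtain P where "biderivation sc P" "\<And>x y. P (sym_of sc x) (sym_of sc y) = sym_of sc (b x y)"
    "\<And>f g. f \<notin> S \<or> g \<notin> S \<Longrightarrow> P f g = 0"
    using leibniz_extension_exists[OF _ assms(2)] assms(1) unfolding fin_dim_def by metis
  moreover from this have "leibniz_ext sc b = P" by (rule leibniz_ext_eqI)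
  ultimately show "biderivation sc (leibniz_ext sc b)"
    "leibniz_ext sc b (sym_of sc x) (sym_of sc y) = sym_of sc (b x y)"
    "f \<notin> S \<or> g \<notin> S \<Longrightarrow> leibniz_ext sc b f g = 0"
    by simp_all
qed

lemma linear_poisson_bracket_leibniz_ext:
  assumes "fin_dim sc" and "lie_algebra sc b"
  shows "linear_poisson_bracket sc (leibniz_ext sc b)"
proof -
  have "bilinear_op b" using assms(2) by (simp add: lie_algebra_iff)
  note ext = leibniz_ext_properties[OF assms(1) this]
  show ?thesis
    by (rule linear_poisson_bracketI[OF assms(2) ext(1)]) (rule ext(2))
qed

lemma leibniz_ext_pencil:
  assumes fd: "fin_dim sc" and a: "bilinear_op a" and b: "bilinear_op b"
  shows "leibniz_ext sc (\<lambda>x y. a x y + sc c (b x y)) f g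
    = leibniz_ext sc a f g + fscale c (leibniz_ext sc b f g)"
proof -
  let ?A = "leibniz_ext sc a" and ?B = "leibniz_ext sc b"
  note A = leibniz_ext_properties[OF fd a] and B = leibniz_ext_properties[OF fd b]
  have dA: "derivation (?A h)" "derivation (\<lambda>f. ?A f h)"
    and dB: "derivation (?B h)" "derivation (\<lambda>f. ?B f h)" if "h \<in> S" for h
    using A(1) B(1) that unfolding biderivation_iff by blast+
  have scaled: "derivation (\<lambda>f. fscale c (d f))" if "derivation d" for d
    by (rule derivation_cong[OF derivation_mult[OF fscale_sym_one_in_Sym[of c] that]])
      (simp add: fscale_mult_left sym_one_mult derivationD(1)[OF that])
  have "leibniz_ext sc (\<lambda>x y. a x y + sc c (b x y)) = (\<lambda>f g. ?A f g + fscale c (?B f g))"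
  proof (rule leibniz_ext_eqI)
    show "biderivation sc (\<lambda>f g. ?A f g + fscale c (?B f g))"
      unfolding biderivation_iff by (intro conjI ballI derivation_add scaled dA dB)
    show "?A (sym_of sc x) (sym_of sc y) + fscale c (?B (sym_of sc x) (sym_of sc y))
        = sym_of sc (a x y + sc c (b x y))" for x y
      unfolding A(2) B(2) by (auto simp: sym_of_def fun_eq_iff fscale_def dual_space_iff)
    show "?A f g + fscale c (?B f g) = 0" if "f \<notin> S \<or> g \<notin> S" for f g
      using A(3)[OF that] B(3)[OF that] by (simp add: fscale_zero)
  qed
  then show ?thesis by simp
qed


section \<open>Isomorphic Lie algebras have isomorphic Poisson brackets\<close>

text \<open>The algebra homomorphism that extends a linear map of the vector space: precomposition
  with the transpose on the dual space.\<close>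

definition sym_map :: "('q \<Rightarrow> 'q) \<Rightarrow> (('q \<Rightarrow> 'k) \<Rightarrow> 'k) \<Rightarrow> ('q \<Rightarrow> 'k) \<Rightarrow> 'k"
  where "sym_map F f = (\<lambda>\<xi>. if \<xi> \<in> U then f (\<xi> \<circ> F) else 0)"

lemma sym_map_hom:
  shows "sym_map F (f + g) = sym_map F f + sym_map F g"
    and "sym_map F (f * g) = sym_map F f * sym_map F g"
    and "sym_map F (fscale c f) = fscale c (sym_map F f)"
  by (auto simp: sym_map_def fun_eq_iff fscale_def)

lemma dual_space_comp:
  "Vector_Spaces.linear sc sc F \<Longrightarrow> \<xi> \<in> U \<Longrightarrow> \<xi> \<circ> F \<in> U"
  unfolding linear_iff_maps dual_space_iff by simp

lemma sym_map_sym_of: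
  assumes "Vector_Spaces.linear sc sc F"
  shows "sym_map F (sym_of sc x) = sym_of sc (F x)"
  using dual_space_comp[OF assms] by (auto simp: sym_map_def sym_of_def fun_eq_iff)

lemma sym_map_in_Sym:
  assumes F: "Vector_Spaces.linear sc sc F" and "f \<in> S"
  shows "sym_map F f \<in> S"
  using assms(2)
proof (induction rule: Sym_induct)
  case (const c)
  have "sym_map F (fscale c sym_one) = fscale c sym_one"
    using dual_space_comp[OF F] by (auto simp: sym_map_def sym_one_def fscale_def fun_eq_iff)
  then show ?case using fscale_sym_one_in_Sym by metis
next
  case (gen x)
  show ?case unfolding sym_map_sym_of[OF F] by (rule sym_of_in_Sym)
next
  case (add f g)
  show ?case unfolding sym_map_hom by (intro Sym_add add)
next
  case (mult f g)
  show ?case unfolding sym_map_hom by (intro Sym_mult mult)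
qed

lemma sym_map_inverse:
  assumes F: "Vector_Spaces.linear sc sc F" and "\<And>x. F (G x) = x" and "f \<in> S"
  shows "sym_map F (sym_map G f) = f"
proof
  fix \<xi> :: "'q \<Rightarrow> 'k"
  have "\<xi> \<circ> F \<circ> G = \<xi>" by (simp add: fun_eq_iff assms(2))
  then show "sym_map F (sym_map G f) \<xi> = f \<xi>"
    using dual_space_comp[OF F] Sym_outside[OF assms(3)] by (simp add: sym_map_def)
qed

lemma linear_inv:
  assumes "Vector_Spaces.linear sc sc F" and "bij F"
  shows "Vector_Spaces.linear sc sc (inv_into UNIV F)"
proof -
  have FG: "F (inv_into UNIV F x) = x" and inj: "F x = F y \<Longrightarrow> x = y" for x y
    using assms(2) by (auto simp: bij_is_surj surj_f_inv_f dest: bij_is_inj injD)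
  have hom: "F (x + y) = F x + F y" "F (sc c x) = sc c (F x)" for c x y
    using assms(1) unfolding linear_iff_maps by blast+
  show ?thesis
    unfolding linear_iff_maps by (intro conjI allI; rule inj) (simp_all only: FG hom)
qed

text \<open>Pulling back the target bracket along the induced algebra automorphism gives a biderivation
  with the same values on generators as the source bracket.\<close>

lemma poisson_isomorphic_of_lie_iso:
  assumes fd: "fin_dim sc" and iso: "lie_iso sc b b' F"
  shows "poisson_isomorphic sc (leibniz_ext sc b) (leibniz_ext sc b')"
proof -
  let ?P = "leibniz_ext sc b" and ?P' = "leibniz_ext sc b'"
  define G where "G = inv_into UNIV F"
  have b: "lie_algebra sc b" and b': "lie_algebra sc b'" and F: "Vector_Spaces.linear sc sc F"
    and "bij F" and hom: "\<And>x y. F (b x y) = b' (F x) (F y)"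
    using iso unfolding lie_iso_def by blast+
  have G: "Vector_Spaces.linear sc sc G"
    unfolding G_def by (rule linear_inv) fact+
  have FG: "F (G x) = x" and GF: "G (F x) = x" for x
    using \<open>bij F\<close> by (simp_all add: G_def bij_is_surj surj_f_inv_f bij_is_inj inv_f_f)
  have "bilinear_op b" "bilinear_op b'" using b b' by (simp_all add: lie_algebra_iff)
  note P = leibniz_ext_properties[OF fd this(1)] and P' = leibniz_ext_properties[OF fd this(2)]
  have dP': "derivation (?P' h)" "derivation (\<lambda>f. ?P' f h)" if "h \<in> S" for h
    using P'(1) that unfolding biderivation_iff by blast+
  let ?T = "sym_map F"
  define Q where "Q f g = sym_map G (?P' (?T f) (?T g))" for f g
  \<comment> \<open>Transporting a derivation along an automorphism of the symmetric algebra.\<close>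
  have transport: "derivation (\<lambda>f. sym_map G (d (?T f)))" if "derivation d" for d
    by (rule derivationI)
      (simp_all only: sym_map_in_Sym F G derivationD[OF that] sym_map_hom
        sym_map_inverse[OF G GF])
  have "biderivation sc Q"
    unfolding Q_def biderivation_iff by (intro conjI ballI transport dP' sym_map_in_Sym F)
  moreover have "?P (sym_of sc x) (sym_of sc y) = Q (sym_of sc x) (sym_of sc y)" for x y
    unfolding Q_def sym_map_sym_of[OF F] P' P hom[symmetric] sym_map_sym_of[OF G] GF ..
  ultimately have "?P f g = Q f g" if "f \<in> S" "g \<in> S" for f g
    using biderivation_eqI[OF P(1)] that by blast
  then have "?T (?P f g) = ?P' (?T f) (?T g)" if "f \<in> S" "g \<in> S" for f g
    using that derivationD(1)[OF dP'(1)] by (simp add: Q_def sym_map_inverse F FG sym_map_in_Sym)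
  moreover have "bij_betw ?T S S"
    by (rule bij_betw_byWitness[where f' = "sym_map G"])
      (auto simp: sym_map_in_Sym F G FG GF sym_map_inverse)
  ultimately show ?thesis
    using linear_poisson_bracket_leibniz_ext[OF fd b] linear_poisson_bracket_leibniz_ext[OF fd b']
    unfolding poisson_isomorphic_def linear_poisson_bracket_def
    by (intro conjI exI[of _ ?T]) (simp_all add: sym_map_hom)
qed


section \<open>Isomorphisms of Lie algebras\<close>

lemma lie_iso_inv:
  assumes "lie_iso sc b b' F"
  shows "lie_iso sc b' b (inv_into UNIV F)"
proof -
  have F: "Vector_Spaces.linear sc sc F" "bij F" and hom: "\<And>x y. F (b x y) = b' (F x) (F y)"
    and lie: "lie_algebra sc b" "lie_algebra sc b'"
    using assms unfolding lie_iso_def by blast+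
  have FG: "F (inv_into UNIV F x) = x" and GF: "inv_into UNIV F (F x) = x" for x
    using F(2) by (simp_all add: bij_is_surj surj_f_inv_f bij_is_inj inv_f_f)
  have "inv_into UNIV F (b' x y) = b (inv_into UNIV F x) (inv_into UNIV F y)" for x y
    using GF[of "b (inv_into UNIV F x) (inv_into UNIV F y)"] by (simp add: hom FG)
  then show ?thesis
    unfolding lie_iso_def using lie linear_inv[OF F] bij_imp_bij_inv[OF F(2)] by blast
qed

lemma lie_iso_comp:
  assumes "lie_iso sc b b' F" and "lie_iso sc b' b'' F'"
  shows "lie_iso sc b b'' (F' \<circ> F)"
proof -
  have F: "Vector_Spaces.linear sc sc F" "bij F" and F': "Vector_Spaces.linear sc sc F'" "bij F'"
    using assms unfolding lie_iso_def by blast+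
  have "Vector_Spaces.linear sc sc (F' \<circ> F)"
    using F(1) F'(1) unfolding linear_iff_maps by simp
  moreover have "bij (F' \<circ> F)" using F(2) F'(2) by (rule bij_comp)
  ultimately show ?thesis using assms unfolding lie_iso_def by simp
qed

lemma lie_iso_transport:
  assumes lie: "lie_algebra sc b" and F: "Vector_Spaces.linear sc sc F" "bij F"
  shows "lie_iso sc b (\<lambda>x y. inv_into UNIV F (b (F x) (F y))) (inv_into UNIV F)"
proof -
  define G where "G = inv_into UNIV F"
  have G: "Vector_Spaces.linear sc sc G" and "bij G"
    unfolding G_def using linear_inv[OF F] bij_imp_bij_inv[OF F(2)] by blast+
  have FG: "F (G x) = x" for x
    using F(2) by (simp add: G_def bij_is_surj surj_f_inv_f)
  have b: "bilinear_op b" and alt: "\<And>x. b x x = 0"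
    and jac: "\<And>x y z. b x (b y z) + b y (b z x) + b z (b x y) = 0"
    using lie by (simp_all add: lie_algebra_iff)
  have Fl: "F (x + y) = F x + F y" "F (sc c x) = sc c (F x)"
    and Gl: "G (x + y) = G x + G y" "G (sc c x) = sc c (G x)" for x y c
    using F(1) G unfolding linear_iff_maps by blast+
  have G0: "G 0 = 0" using Gl(2)[of 0 0] by simp
  have "bilinear_op (\<lambda>x y. G (b (F x) (F y)))"
    unfolding bilinear_op_def linear_iff_maps by (simp add: Fl Gl bilinear_op_simps[OF b])
  then have "lie_algebra sc (\<lambda>x y. G (b (F x) (F y)))"
    unfolding lie_algebra_iff by (simp add: FG alt jac G0 flip: Gl)
  then show ?thesis
    unfolding lie_iso_def G_def[symmetric] using lie G \<open>bij G\<close> by (simp add: FG)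
qed

end


section \<open>Gradings by a cyclic group\<close>

locale cyclic_grading = char0_vector_space sc
  for sc :: "'k::field_char_0 \<Rightarrow> 'q::ab_group_add \<Rightarrow> 'q" +
  fixes br :: "'q \<Rightarrow> 'q \<Rightarrow> 'q" and \<theta> :: "'q \<Rightarrow> 'q" and m :: nat and \<zeta> :: 'k
  assumes aut: "lie_aut_of_order sc br \<theta> m" and root: "primitive_root_of_unity m \<zeta>"
begin

lemma m_pos: "0 < m" and zeta_pow: "\<zeta> ^ m = 1" and zeta_nz: "\<zeta> \<noteq> 0"
  using root by (auto simp: primitive_root_of_unity_def zero_power)

lemma lie: "lie_algebra sc br" and bilinear_br: "bilinear_op br"
  and theta_linear: "Vector_Spaces.linear sc sc \<theta>"
  and theta_br: "\<theta> (br x y) = br (\<theta> x) (\<theta> y)" and theta_order: "\<theta> ^^ m = id"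
  using aut by (auto simp: lie_aut_of_order_def lie_iso_def lie_algebra_iff)

lemma theta_simps: "\<theta> (x + y) = \<theta> x + \<theta> y" "\<theta> (sc c x) = sc c (\<theta> x)"
  using theta_linear unfolding linear_iff_maps by blast+

text \<open>The projection onto the homogeneous component of degree \<open>j\<close>, obtained by averaging
  \<open>\<zeta> ^ (- j * k) * \<theta> ^ k\<close> over the cyclic group generated by \<open>\<theta>\<close>.\<close>

definition homog :: "nat \<Rightarrow> 'q \<Rightarrow> 'q"
  where "homog j x = sc (1 / of_nat m) (\<Sum>k<m. sc (inverse \<zeta> ^ (j * k)) ((\<theta> ^^ k) x))"

lemma homog_linear: "homog j (x + y) = homog j x + homog j y" "homog j (sc c x) = sc c (homog j x)"
proof -
  have pow: "(\<theta> ^^ k) (x + y) = (\<theta> ^^ k) x + (\<theta> ^^ k) y" "(\<theta> ^^ k) (sc c x) = sc c ((\<theta> ^^ k) x)"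
    for k x y c
    by (induction k) (simp_all add: theta_simps)
  show "homog j (x + y) = homog j x + homog j y" "homog j (sc c x) = sc c (homog j x)"
    unfolding homog_def by (simp_all add: pow scale_right_distrib sum.distrib scale_sum_right mult_ac)
qed

text \<open>Applying \<open>\<theta>\<close> shifts the summation index cyclically.\<close>

lemma homog_in_graded_part: "homog j x \<in> graded_part sc \<theta> \<zeta> j"
proof -
  define g where "g k = sc (inverse \<zeta> ^ (j * k)) ((\<theta> ^^ k) x)" for k
  have step: "\<theta> (g k) = sc (\<zeta> ^ j) (g (Suc k))" for k
    using zeta_nz by (simp add: g_def theta_simps power_add flip: power_mult_distrib)
  have "inverse \<zeta> ^ (j * m) = 1"
    by (simp add: power_inverse zeta_pow mult.commute[of j] power_mult)
  then have "g m = g 0" by (simp add: g_def theta_order)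
  then have shift: "(\<Sum>k<m. g (Suc k)) = (\<Sum>k<m. g k)"
    using sum.lessThan_Suc_shift[of g m] by (simp add: add.commute)
  have "\<theta> (homog j x) = sc (1 / of_nat m) (\<Sum>k<m. sc (\<zeta> ^ j) (g (Suc k)))"
    unfolding homog_def by (simp add: theta_simps linear_sum[OF theta_linear] step flip: g_def)
  also have "\<dots> = sc (\<zeta> ^ j) (sc (1 / of_nat m) (\<Sum>k<m. g (Suc k)))"
    by (simp add: scale_sum_right mult.commute)
  also have "\<dots> = sc (\<zeta> ^ j) (homog j x)"
    unfolding shift unfolding homog_def g_def ..
  finally show ?thesis by (simp add: graded_part_def)
qed

text \<open>The powers of a nontrivial \<open>m\<close>-th root of unity sum to zero.\<close>

lemma sum_homog: "(\<Sum>j<m. homog j x) = x"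
proof -
  have rs: "(\<Sum>j<m. inverse \<zeta> ^ (j * k)) = (if k = 0 then of_nat m else 0)" if "k < m" for k
  proof (cases "k = 0")
    case False
    then have "\<zeta> ^ k \<noteq> 1" using root that by (simp add: primitive_root_of_unity_def)
    then have "inverse \<zeta> ^ k \<noteq> 1" by (simp add: power_inverse)
    moreover have "(inverse \<zeta> ^ k) ^ m = 1"
      by (simp add: power_inverse zeta_pow flip: power_mult) 
         (simp add: power_mult mult.commute[of k] zeta_pow)
    ultimately have "(\<Sum>j<m. (inverse \<zeta> ^ k) ^ j) = 0"
      by (simp add: geometric_sum)
    then show ?thesis using False by (simp add: mult.commute[of _ k] power_mult)
  qed simp
  have "(\<Sum>j<m. homog j x)
      = sc (1 / of_nat m) (\<Sum>j<m. \<Sum>k<m. sc (inverse \<zeta> ^ (j * k)) ((\<theta> ^^ k) x))"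
    unfolding homog_def by (simp add: scale_sum_right)
  also have "\<dots> = sc (1 / of_nat m) (\<Sum>k<m. sc (\<Sum>j<m. inverse \<zeta> ^ (j * k)) ((\<theta> ^^ k) x))"
    by (subst sum.swap) (simp add: scale_sum_left)
  also have "\<dots> = sc (1 / of_nat m) (\<Sum>k<m. if k = 0 then sc (of_nat m) x else 0)"
    by (intro arg_cong[of _ _ "sc _"] sum.cong) (simp_all add: rs)
  also have "\<dots> = x" using m_pos by simp
  finally show ?thesis .
qed

lemma linear_eq_sum_homog:
  assumes F: "Vector_Spaces.linear sc sc F"
    and diag: "\<And>j x. j < m \<Longrightarrow> x \<in> graded_part sc \<theta> \<zeta> j \<Longrightarrow> F x = sc (c j) x"
  shows "F x = (\<Sum>j<m. sc (c j) (homog j x))"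
proof -
  have "F x = (\<Sum>j<m. F (homog j x))"
    by (subst sum_homog[symmetric]) (rule linear_sum[OF F])
  then show ?thesis by (simp add: diag homog_in_graded_part)
qed

lemma br_in_graded_part:
  assumes "x \<in> graded_part sc \<theta> \<zeta> i" and "y \<in> graded_part sc \<theta> \<zeta> j"
  shows "br x y \<in> graded_part sc \<theta> \<zeta> ((i + j) mod m)"
proof -
  have "\<zeta> ^ (i + j) = \<zeta> ^ ((i + j) div m * m + (i + j) mod m)" by simp
  also have "\<dots> = (\<zeta> ^ m) ^ ((i + j) div m) * \<zeta> ^ ((i + j) mod m)"
    by (simp only: power_add power_mult mult.commute[of _ m])
  finally have "\<zeta> ^ ((i + j) mod m) = \<zeta> ^ i * \<zeta> ^ j" by (simp add: zeta_pow power_add)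
  then show ?thesis
    using assms by (simp add: graded_part_def theta_br bilinear_op_simps[OF bilinear_br])
qed

text \<open>The bracket splits according to whether the degrees in \<open>{0..<m}\<close> add without or with a
  carry modulo \<open>m\<close>. Both parts are defined as explicit double sums, so that bilinearity does not
  depend on limits.\<close>

definition br_zero :: "'q \<Rightarrow> 'q \<Rightarrow> 'q"
  where "br_zero x y = (\<Sum>i<m. \<Sum>j<m. if i + j < m then br (homog i x) (homog j y) else 0)"

definition br_infinity :: "'q \<Rightarrow> 'q \<Rightarrow> 'q"
  where "br_infinity x y = (\<Sum>i<m. \<Sum>j<m. if m \<le> i + j then br (homog i x) (homog j y) else 0)"

lemma bilinear_br_zero: "bilinear_op br_zero" and bilinear_br_infinity: "bilinear_op br_infinity"
proof -
  have "bilinear_op (\<lambda>x y. \<Sum>i<m. \<Sum>j<m. if C i j then br (homog i x) (homog j y) else 0)" for C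
    unfolding bilinear_op_def linear_iff_maps
    by (simp add: homog_linear bilinear_op_simps[OF bilinear_br] scale_sum_right
        if_distrib[of "sc _"] flip: sum.distrib cong: if_cong)
       (auto intro!: sum.cong)
  from this[of "\<lambda>i j. i + j < m"] this[of "\<lambda>i j. m \<le> i + j"]
  show "bilinear_op br_zero" "bilinear_op br_infinity"
    unfolding br_zero_def[abs_def] br_infinity_def[abs_def] .
qed

lemma br_eq: "br x y = br_zero x y + br_infinity x y"
proof -
  have "br x y = br (\<Sum>i<m. homog i x) (\<Sum>j<m. homog j y)" by (simp only: sum_homog)
  also have "\<dots> = (\<Sum>i<m. \<Sum>j<m. br (homog i x) (homog j y))"
    unfolding bilinear_op_sum(1)[OF bilinear_br] unfolding bilinear_op_sum(2)[OF bilinear_br] ..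
  also have "\<dots> = br_zero x y + br_infinity x y"
    unfolding br_zero_def br_infinity_def by (simp flip: sum.distrib cong: if_cong) 
      (intro sum.cong refl, simp)
  finally show ?thesis .
qed

end

section \<open>The contraction and its reversal\<close>

locale cyclic_contraction = cyclic_grading sc br \<theta> m \<zeta>
  for sc :: "'k::field_char_0 \<Rightarrow> 'q::ab_group_add \<Rightarrow> 'q" and br \<theta> m \<zeta> +
  fixes \<phi> :: "'k \<Rightarrow> 'q \<Rightarrow> 'q"
  assumes rep: "poly_rep sc \<phi>"
    and diag: "s \<noteq> 0 \<Longrightarrow> j < m \<Longrightarrow> x \<in> graded_part sc \<theta> \<zeta> j \<Longrightarrow> \<phi> s x = sc (s ^ j) x"
begin

lemma phi_linear: "s \<noteq> 0 \<Longrightarrow> Vector_Spaces.linear sc sc (\<phi> s)"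
  and phi_bij: "s \<noteq> 0 \<Longrightarrow> bij (\<phi> s)"
  and phi_mult: "s \<noteq> 0 \<Longrightarrow> t \<noteq> 0 \<Longrightarrow> \<phi> (s * t) = \<phi> s \<circ> \<phi> t"
  using rep unfolding poly_rep_def by blast+

lemma phi_one: "\<phi> 1 x = x"
proof -
  have "\<phi> 1 (\<phi> 1 x) = \<phi> 1 x" using phi_mult[of 1 1] by (simp add: fun_eq_iff)
  then show ?thesis using phi_bij[of 1] by (simp add: bij_is_inj inj_eq)
qed

lemma phi_phi_inverse: "s \<noteq> 0 \<Longrightarrow> \<phi> s (\<phi> (inverse s) x) = x"
  using phi_mult[of s "inverse s"] phi_one[of x] by (simp add: fun_eq_iff)

lemma inv_phi: assumes "s \<noteq> 0" shows "inv_into UNIV (\<phi> s) = \<phi> (inverse s)"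
  using phi_phi_inverse[of s] phi_phi_inverse[of "inverse s"] assms
  by (intro inv_unique_comp) (simp_all add: fun_eq_iff)

lemma lie_iso_twisted:
  "s \<noteq> 0 \<Longrightarrow> lie_iso sc br (twisted_bracket br \<phi> s) (inv_into UNIV (\<phi> s))"
  using lie_iso_transport[OF lie phi_linear phi_bij, of s]
  by (simp add: twisted_bracket_def[abs_def])

text \<open>On \<open>\<qq>\<^sub>i \<times> \<qq>\<^sub>j\<close> the twisted bracket is the bracket scaled by
  \<open>s ^ (i + j)\<close> and divided by \<open>s ^ ((i + j) mod m)\<close>; the reduction modulo \<open>m\<close>
  leaves \<open>1\<close> or \<open>s ^ m\<close>.\<close>

lemma twisted_bracket_eq:
  assumes s: "s \<noteq> 0"
  shows "twisted_bracket br \<phi> s x y = br_zero x y + sc (s ^ m) (br_infinity x y)"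
proof -
  define G where "G = \<phi> (inverse s)"
  have G: "Vector_Spaces.linear sc sc G" unfolding G_def using s by (intro phi_linear) simp
  have Gsc: "G (sc c x) = sc c (G x)" for c x using G unfolding linear_iff_maps by blast
  have phi: "\<phi> s x = (\<Sum>j<m. sc (s ^ j) (homog j x))" for x
    using linear_eq_sum_homog[OF phi_linear[OF s]] diag[OF s] by blast
  have summand: "sc (s ^ i) (sc (s ^ j) (G (br (homog i x) (homog j y))))
      = (if i + j < m then br (homog i x) (homog j y) else 0)
        + sc (s ^ m) (if m \<le> i + j then br (homog i x) (homog j y) else 0)"
    if "i < m" "j < m" for i j
  proof -
    define r where "r = (i + j) mod m"
    have "r < m" using m_pos by (simp add: r_def)
    have "G (br (homog i x) (homog j y)) = sc (inverse s ^ r) (br (homog i x) (homog j y))"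
      using diag[of "inverse s" r] br_in_graded_part[OF homog_in_graded_part homog_in_graded_part] s
        \<open>r < m\<close> by (simp add: G_def r_def)
    moreover have "s ^ i * (s ^ j * inverse s ^ r) = (if i + j < m then 1 else s ^ m)"
    proof -
      have "i + j = r + (if i + j < m then 0 else m)"
        using that by (auto simp: r_def mod_if)
      then have "s ^ i * s ^ j = s ^ (r + (if i + j < m then 0 else m))"
        by (simp only: power_add[symmetric])
      then have "s ^ i * s ^ j = s ^ r * (if i + j < m then 1 else s ^ m)"
        by (simp add: power_add split: if_splits)
      then have "s ^ i * s ^ j * inverse s ^ r = (if i + j < m then 1 else s ^ m)"
        using s by (simp add: power_inverse)
      then show ?thesis by (simp add: mult.assoc)
    qed
    ultimately show ?thesis by (simp split: if_splits)
  qed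
  have "twisted_bracket br \<phi> s x y
      = G (br (\<Sum>i<m. sc (s ^ i) (homog i x)) (\<Sum>j<m. sc (s ^ j) (homog j y)))"
    unfolding twisted_bracket_def inv_phi[OF s] G_def[symmetric] phi ..
  also have "\<dots> = (\<Sum>i<m. \<Sum>j<m. sc (s ^ i) (sc (s ^ j) (G (br (homog i x) (homog j y)))))"
    unfolding bilinear_op_sum(1)[OF bilinear_br] bilinear_op_simps(3)[OF bilinear_br]
    unfolding bilinear_op_sum(2)[OF bilinear_br] bilinear_op_simps(4)[OF bilinear_br]
      linear_sum[OF G] Gsc scale_sum_right ..
  also have "\<dots> = br_zero x y + sc (s ^ m) (br_infinity x y)"
    unfolding br_zero_def br_infinity_def scale_sum_right sum.distrib[symmetric]
    by (intro sum.cong refl summand) simp_all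
  finally show ?thesis .
qed

text \<open>Every member of the pencil with a parameter \<open>s \<noteq> 0\<close> is isomorphic to the given Lie
  algebra, which forces both ends of the pencil to be Lie brackets.\<close>

lemma lie_br_zero: "lie_algebra sc br_zero" and lie_br_infinity: "lie_algebra sc br_infinity"
proof -
  have "lie_algebra sc (\<lambda>x y. br_zero x y + sc (s ^ m) (br_infinity x y))" if "s \<noteq> 0" for s
  proof -
    have "twisted_bracket br \<phi> s = (\<lambda>x y. br_zero x y + sc (s ^ m) (br_infinity x y))"
      using that by (simp add: fun_eq_iff twisted_bracket_eq)
    then show ?thesis using lie_iso_twisted[OF that] by (simp add: lie_iso_def)
  qed
  then show "lie_algebra sc br_zero" "lie_algebra sc br_infinity"
    using lie_pencil_ends[OF bilinear_br_zero bilinear_br_infinity m_pos] by blast+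
qed

definition \<psi> :: "'k \<Rightarrow> 'q \<Rightarrow> 'q"
  where "\<psi> s x = sc (s ^ m) (\<phi> (inverse s) x)"

lemma inv_psi: assumes "s \<noteq> 0"
  shows "bij (\<psi> s)" and "inv_into UNIV (\<psi> s) x = sc (inverse s ^ m) (\<phi> s x)"
proof -
  define H where "H x = sc (inverse s ^ m) (\<phi> s x)" for x
  have sc: "\<phi> t (sc c x) = sc c (\<phi> t x)" if "t \<noteq> 0" for t c x
    using phi_linear[OF that] unfolding linear_iff_maps by blast
  have one: "s ^ m * inverse s ^ m = 1" using assms by (simp add: power_inverse)
  have "\<psi> s \<circ> H = id" "H \<circ> \<psi> s = id"
    using phi_phi_inverse[of s] phi_phi_inverse[of "inverse s"] assms
    by (simp_all add: fun_eq_iff \<psi>_def H_def sc one mult.commute[of "inverse s ^ m"])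
  then show "bij (\<psi> s)" and "inv_into UNIV (\<psi> s) x = sc (inverse s ^ m) (\<phi> s x)"
    by (auto simp: o_bij inv_unique_comp[of _ H] H_def)
qed

lemma poly_rep_psi: "poly_rep sc \<psi>"
  unfolding poly_rep_def
proof (intro conjI allI impI ballI)
  fix s :: 'k assume s: "s \<noteq> 0"
  then have phi: "\<phi> (inverse s) (x + y) = \<phi> (inverse s) x + \<phi> (inverse s) y"
    "\<phi> (inverse s) (sc c x) = sc c (\<phi> (inverse s) x)" for x y c
    using phi_linear[of "inverse s"] unfolding linear_iff_maps by auto
  show "Vector_Spaces.linear sc sc (\<psi> s)"
    unfolding linear_iff_maps by (simp add: \<psi>_def phi scale_right_distrib mult.commute)
  show "bij (\<psi> s)" by (rule inv_psi(1)[OF s])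
  fix t :: 'k assume t: "t \<noteq> 0"
  then show "\<psi> (s * t) = \<psi> s \<circ> \<psi> t"
    using s phi_mult[of "inverse s" "inverse t"]
    by (simp add: fun_eq_iff \<psi>_def phi power_mult_distrib)
next
  fix B b b' assume "finite_dimensional_vector_space sc B"
  then interpret fd: finite_dimensional_vector_space sc B .
  define p where "p = (\<Sum>j<m. monom (representation B (homog j b) b') (m - j))"
  show "\<exists>p. \<forall>s. s \<noteq> 0 \<longrightarrow> representation B (\<psi> s b) b' = poly p s"
  proof (intro exI allI impI)
    fix s :: 'k assume s: "s \<noteq> 0"
    then have phi: "\<phi> (inverse s) b = (\<Sum>j<m. sc (inverse s ^ j) (homog j b))"
      using linear_eq_sum_homog[OF phi_linear[of "inverse s"]] diag[of "inverse s"] by simp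
    have pow: "s ^ m * inverse s ^ j = s ^ (m - j)" if "j < m" for j
      using s that by (simp add: power_diff power_inverse divide_inverse)
    have "\<psi> s b = (\<Sum>j<m. sc (s ^ (m - j)) (homog j b))"
      unfolding \<psi>_def phi by (simp add: scale_sum_right pow)
    then show "representation B (\<psi> s b) b' = poly p s"
      by (simp add: p_def poly_sum poly_monom representation_sum representation_scale
          fd.span_Basis fd.independent_Basis mult.commute)
  qed
qed

text \<open>Since \<open>\<psi>\<^sub>s\<close> is a scalar multiple of \<open>\<phi>\<^sub>s\<inverse>\<close>, twisting by \<open>\<psi>\<^sub>s\<close> is \<open>s ^ m\<close>
  times twisting by \<open>\<phi>\<close> at the parameter \<open>1 / s\<close>. This reverses the pencil.\<close>

lemma twisted_bracket_psi:
  assumes s: "s \<noteq> 0"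
  shows "twisted_bracket br \<psi> s x y = br_infinity x y + sc (s ^ m) (br_zero x y)"
proof -
  have sc: "\<phi> s (sc c x) = sc c (\<phi> s x)" for c x
    using phi_linear[OF s] unfolding linear_iff_maps by blast
  have one: "s ^ m * inverse s ^ m = 1" using assms by (simp add: power_inverse)
  have "twisted_bracket br \<psi> s x y
      = sc (inverse s ^ m * (s ^ m * s ^ m)) (\<phi> s (br (\<phi> (inverse s) x) (\<phi> (inverse s) y)))"
    unfolding twisted_bracket_def inv_psi(2)[OF s]
    by (simp add: \<psi>_def bilinear_op_simps[OF bilinear_br] sc mult.assoc)
  also have "inverse s ^ m * (s ^ m * s ^ m) = s ^ m"
    using s by (simp add: power_inverse)
  also have "\<phi> s (br (\<phi> (inverse s) x) (\<phi> (inverse s) y)) = twisted_bracket br \<phi> (inverse s) x y"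
    using s by (simp add: twisted_bracket_def inv_phi)
  also have "\<dots> = br_zero x y + sc (inverse s ^ m) (br_infinity x y)"
    using s by (simp add: twisted_bracket_eq)
  finally show ?thesis by (simp add: scale_right_distrib one add.commute)
qed

end

section \<open>Compatible Poisson brackets from an automorphism of finite order\<close>

theorem proposition2p1:
  fixes sc :: "'k::{alg_closed_field, field_char_0} \<Rightarrow> 'q::ab_group_add \<Rightarrow> 'q"
    and br :: "'q \<Rightarrow> 'q \<Rightarrow> 'q"
    and \<theta> :: "'q \<Rightarrow> 'q"
    and m :: nat
    and \<zeta> :: 'k
    and \<phi> :: "'k \<Rightarrow> 'q \<Rightarrow> 'q"
  assumes "fin_dim sc"
    and "algebraic_lie_algebra sc br"
    and "m \<ge> 2"
    and "lie_aut_of_order sc br \<theta> m"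
    and "primitive_root_of_unity m \<zeta>"
    and "poly_rep sc \<phi>"
    and "\<And>s j x. s \<noteq> 0 \<Longrightarrow> j < m \<Longrightarrow> x \<in> graded_part sc \<theta> \<zeta> j \<Longrightarrow> \<phi> s x = sc (s ^ j) x"
  shows
    "let br_s = twisted_bracket br \<phi>;
         br_0 = (\<lambda>x y. zero_limit sc (\<lambda>s. br_s s x y));
         P = leibniz_ext sc br;
         P_s = (\<lambda>s. leibniz_ext sc (br_s s));
         P_0 = leibniz_ext sc br_0;
         P_inf = P - P_0;
         \<psi> = (\<lambda>s x. sc (s ^ m) (\<phi> (inverse s) x));
         br_\<psi> = twisted_bracket br \<psi>
     in
       (\<comment> \<open>(i)\<close>
        (\<forall>s. s \<noteq> 0 \<longrightarrow> lie_iso sc br (br_s s) (inv_into UNIV (\<phi> s))) \<and>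
        (\<forall>s t. s \<noteq> 0 \<longrightarrow> t \<noteq> 0 \<longrightarrow> poisson_isomorphic sc (P_s s) (P_s t))) \<and>
       (\<comment> \<open>(ii)\<close>
        (\<forall>x y. has_zero_limit sc (\<lambda>s. br_s s x y) (br_0 x y)) \<and>
        linear_poisson_bracket sc P_0) \<and>
       (\<comment> \<open>(iii)\<close>
        linear_poisson_bracket sc P_inf \<and>
        (\<forall>s. s \<noteq> 0 \<longrightarrow> (\<forall>f g. P_s s f g = P_0 f g + fscale (s ^ m) (P_inf f g)))) \<and>
       (\<comment> \<open>(iv)\<close>
        poly_rep sc \<psi> \<and>
        (\<forall>s x. s \<noteq> 0 \<longrightarrow> \<psi> s x = sc (s ^ m) (inv_into UNIV (\<phi> s) x)) \<and>
        (\<forall>x y. has_zero_limit sc (\<lambda>s. br_\<psi> s x y) (zero_limit sc (\<lambda>s. br_\<psi> s x y))) \<and>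
        P_inf = leibniz_ext sc (\<lambda>x y. zero_limit sc (\<lambda>s. br_\<psi> s x y)))"
proof -
  have "vector_space sc"
    using assms(2) by (simp add: algebraic_lie_algebra_def lie_algebra_def)
  then interpret char0_vector_space sc by (simp add: char0_vector_space_def)
  interpret C: cyclic_contraction sc br \<theta> m \<zeta> \<phi>
    by unfold_locales (fact assms)+
  note fd = assms(1)
  \<comment> \<open>Once the limits are identified with the two ends of the pencil, every assertion is about
    the brackets \<open>C.br_zero\<close> and \<open>C.br_infinity\<close>.\<close>
  have psi: "(\<lambda>s x. sc (s ^ m) (\<phi> (inverse s) x)) = C.\<psi>"
    by (simp add: fun_eq_iff C.\<psi>_def)
  have lim0: "has_zero_limit sc (\<lambda>s. twisted_bracket br \<phi> s x y) (C.br_zero x y)" for x y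
    using has_zero_limit_binomial[OF C.m_pos C.twisted_bracket_eq] .
  have lim_psi: "has_zero_limit sc (\<lambda>s. twisted_bracket br C.\<psi> s x y) (C.br_infinity x y)" for x y
    using has_zero_limit_binomial[OF C.m_pos C.twisted_bracket_psi] .
  have zl0: "(\<lambda>x y. zero_limit sc (\<lambda>s. twisted_bracket br \<phi> s x y)) = C.br_zero"
    using zero_limit_eq[OF lim0] by blast
  have zl_psi: "(\<lambda>x y. zero_limit sc (\<lambda>s. twisted_bracket br C.\<psi> s x y)) = C.br_infinity"
    using zero_limit_eq[OF lim_psi] by blast
  have pencil: "leibniz_ext sc (\<lambda>x y. C.br_zero x y + sc c (C.br_infinity x y)) f g
      = leibniz_ext sc C.br_zero f g + fscale c (leibniz_ext sc C.br_infinity f g)" for c f g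
    by (rule leibniz_ext_pencil[OF fd C.bilinear_br_zero C.bilinear_br_infinity])
  have "br = (\<lambda>x y. C.br_zero x y + sc 1 (C.br_infinity x y))"
    by (simp add: fun_eq_iff C.br_eq)
  then have "leibniz_ext sc br f g = leibniz_ext sc C.br_zero f g + leibniz_ext sc C.br_infinity f g" for f g
    using pencil[of 1 f g] by (simp add: fscale_one)
  then have Pinf: "leibniz_ext sc br - leibniz_ext sc C.br_zero = leibniz_ext sc C.br_infinity"
    by (simp add: fun_eq_iff)
  have iso: "poisson_isomorphic sc (leibniz_ext sc (twisted_bracket br \<phi> s))
      (leibniz_ext sc (twisted_bracket br \<phi> t))" if "s \<noteq> 0" "t \<noteq> 0" for s t
    using lie_iso_comp[OF lie_iso_inv[OF C.lie_iso_twisted[OF that(1)]] C.lie_iso_twisted[OF that(2)]]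
    by (rule poisson_isomorphic_of_lie_iso[OF fd])
  have Ps: "leibniz_ext sc (twisted_bracket br \<phi> s) f g
      = leibniz_ext sc C.br_zero f g + fscale (s ^ m) (leibniz_ext sc C.br_infinity f g)"
    if "s \<noteq> 0" for s f g
  proof -
    have "twisted_bracket br \<phi> s = (\<lambda>x y. C.br_zero x y + sc (s ^ m) (C.br_infinity x y))"
      using that by (simp add: fun_eq_iff C.twisted_bracket_eq)
    then show ?thesis by (simp only: pencil)
  qed
  show ?thesis
    unfolding Let_def psi zl0 zl_psi Pinf
    using C.lie_iso_twisted iso lim0 lim_psi Ps C.poly_rep_psi
      linear_poisson_bracket_leibniz_ext[OF fd C.lie_br_zero]
      linear_poisson_bracket_leibniz_ext[OF fd C.lie_br_infinity]
    by (simp add: zero_limit_eq[OF lim0] zero_limit_eq[OF lim_psi] C.inv_phi C.\<psi>_def)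
qed

end
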